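(* Let $D$ be a $\mathbb Z$-algebra generated by commuting idempotents, isomorphic to $C_0(\Omega,\mathbb Z)$ for some totally disconnected locally compact Hausdorff space $\Omega$, and let a group $\Gamma$ act on $D$ by $\mathbb Z$-algebra automorphisms. Then: (i) There always exists a $\Gamma$-semilattice $E$ with a $\Gamma$-equivariant surjective homomorphism $\varphi:\mathbb Z[E^\times]\to D$ of $\mathbb Z$-algebras. (ii) Choose $E$ and $\varphi$ with the properties in (i). Set $E_0:=E$, $\varphi_0:=\varphi$, and recursively let $E_{k+1}:=(E_k)_{\varphi_k}$ and let $\varphi_{k+1}:\mathbb Z[E_{k+1}^\times]\to\mathbb Z[E_k^\times]$ be the homomorphism induced by the inclusion $E_{k+1}\hookrightarrow\mathbb Z[E_k^\times]$; equip all these semilattices with the canonical $\Gamma$-actions. Then $$\cdots\to\mathbb Z[E_k^\times]\to\cdots\to\mathbb Z[E_2^\times]\to\mathbb Z[E_1^\times]\to\mathbb Z[E^\times]\to D\to0$$ is an algebraic independent resolution of $D$. (iii) If $\Gamma$ is torsion-free, then there always exist a $\Gamma$-semilattice $E$ and $\varphi$ as in (i) such that the corresponding algebraic independent resolution in (ii) has the property that $\Gamma$ acts freely on $E_k^\times$ for every $k\ge0$.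
   Context: A semilattice is a commutative semigroup $E$ in which every element is idempotent; all semilattices have a zero element $0$ (so $0e=0$). Write $e\le f$ if $ef=e$, and $e\lneq f$ if $e\le f$ and $e\neq f$. Put $E^\times=E\setminus\{0\}$. $\mathbb Z[E^\times]$ is the free $\mathbb Z$-module on $E^\times$ with the bilinear multiplication for which the product of basis elements $e,f$ is $ef$ if $ef\ne0$ in $E$ and $0$ otherwise. $\mathbb Z$-algebras need not be unital. A map from a semilattice to idempotents of a commutative $\mathbb Z$-algebra $A$ which is multiplicative and sends $0$ to $0$ extends uniquely to a $\mathbb Z$-algebra homomorphism $\mathbb Z[E^\times]\to A$. A $\Gamma$-semilattice is a semilattice with an action of $\Gamma$ by semigroup automorphisms; it induces an action on $\mathbb Z[E^\times]$. $C_0(\Omega,\mathbb Z)$ denotes the $\mathbb Z$-algebra of compactly supported continuous (locally constant) functions $\Omega\to\mathbb Z$. For finitely many commuting idempotents, $\bigvee_{j\in J}e_j=\sum_{\varnothing\ne J'\subseteq J}(-1)^{|J'|-1}\prod_{j\in J'}e_j$ (zero if $J=\varnothing$). For a homomorphism $\varphi:\mathbb Z[E^\times]\to D$ of $\mathbb Z$-algebras into a $\mathbb Z$-algebra generated by commuting idempotents, set $$E_\varphi=\Big\{e-\bigvee_{j\in J}e_j\in\mathbb Z[E^\times]: J\text{ a finite set (possibly empty)},\ e,e_j\in E^\times,\ e_j\lneq e,\ \varphi(e)=\bigvee_{j\in J}\varphi(e_j)\Big\}\cup\{0\}.$$ It is a semilattice under the multiplication of $\mathbb Z[E^\times]$ consisting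 of idempotents; if $\Gamma$ acts on $E$ and $D$ and $\varphi$ is equivariant, the $\Gamma$-action on $\mathbb Z[E^\times]$ restricts to a $\Gamma$-action on $E_\varphi$ (the canonical action). In the claim, $(E_k)_{\varphi_k}$ is this construction applied to $E_k$ and $\varphi_k$. An algebraic independent resolution of $D$ (with its $\Gamma$-action) is a long exact sequence $\cdots\to\mathbb Z[E_2^\times]\to\mathbb Z[E_1^\times]\to\mathbb Z[E_0^\times]\to D\to0$ of $\Gamma$-equivariant homomorphisms, where the $E_k$ are $\Gamma$-semilattices. An action on a set is free if all point stabilizers are trivial. *)

theory Defs
  imports
    "HOL-Algebra.Group_Action"
    "HOL-Algebra.AbelCoset"
    "HOL-Algebra.Free_Abelian_Groups"
    "HOL-Library.FSet"
    "HOL-Analysis.Analysis"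
begin

text \<open>
  \<open>\<int>\<close>-algebras are carried by the record \<^typ>\<open>'a ring\<close>. They need not be unital: the field
  \<^const>\<open>one\<close> is never used, neither in the axioms nor in the notion of homomorphism.
\<close>

locale z_algebra = abelian_group R for R :: "('a, 'm) ring_scheme" (structure) +
  assumes m_closed: "\<lbrakk>x \<in> carrier R; y \<in> carrier R\<rbrakk> \<Longrightarrow> x \<otimes> y \<in> carrier R"
    and m_assoc: "\<lbrakk>x \<in> carrier R; y \<in> carrier R; z \<in> carrier R\<rbrakk> \<Longrightarrow> (x \<otimes> y) \<otimes> z = x \<otimes> (y \<otimes> z)"
    and l_distr: "\<lbrakk>x \<in> carrier R; y \<in> carrier R; z \<in> carrier R\<rbrakk> \<Longrightarrow> (x \<oplus> y) \<otimes> z = x \<otimes> z \<oplus> y \<otimes> z"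
    and r_distr: "\<lbrakk>x \<in> carrier R; y \<in> carrier R; z \<in> carrier R\<rbrakk> \<Longrightarrow> z \<otimes> (x \<oplus> y) = z \<otimes> x \<oplus> z \<otimes> y"

definition alg_hom :: "('a, 'm) ring_scheme \<Rightarrow> ('b, 'n) ring_scheme \<Rightarrow> ('a \<Rightarrow> 'b) set" where
  "alg_hom R S = {h \<in> carrier R \<rightarrow> carrier S.
     (\<forall>x\<in>carrier R. \<forall>y\<in>carrier R.
        h (x \<oplus>\<^bsub>R\<^esub> y) = h x \<oplus>\<^bsub>S\<^esub> h y \<and> h (x \<otimes>\<^bsub>R\<^esub> y) = h x \<otimes>\<^bsub>S\<^esub> h y)}"

definition alg_isomorphic :: "('a, 'm) ring_scheme \<Rightarrow> ('b, 'n) ring_scheme \<Rightarrow> bool" where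
  "alg_isomorphic R S \<longleftrightarrow> (\<exists>h\<in>alg_hom R S. bij_betw h (carrier R) (carrier S))"

definition subalgebra_of :: "'a set \<Rightarrow> ('a, 'm) ring_scheme \<Rightarrow> bool" where
  "subalgebra_of S R \<longleftrightarrow> S \<subseteq> carrier R \<and> \<zero>\<^bsub>R\<^esub> \<in> S \<and>
     (\<forall>x\<in>S. \<forall>y\<in>S. x \<ominus>\<^bsub>R\<^esub> y \<in> S \<and> x \<otimes>\<^bsub>R\<^esub> y \<in> S)"

definition generated_by_commuting_idempotents :: "('a, 'm) ring_scheme \<Rightarrow> bool" where
  "generated_by_commuting_idempotents R \<longleftrightarrow>
     (\<exists>P \<subseteq> carrier R.
        (\<forall>p\<in>P. p \<otimes>\<^bsub>R\<^esub> p = p) \<and> (\<forall>p\<in>P. \<forall>q\<in>P. p \<otimes>\<^bsub>R\<^esub> q = q \<otimes>\<^bsub>R\<^esub> p) \<and>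
        \<Inter>{S. subalgebra_of S R \<and> P \<subseteq> S} = carrier R)"

text \<open>
  The product of a non-empty finite family is taken after formally adjoining a unit
  (\<^const>\<open>None\<close>), since \<^const>\<open>finprod\<close> presupposes a monoid.
\<close>

definition adjoin_one :: "('a, 'm) ring_scheme \<Rightarrow> 'a option monoid" where
  "adjoin_one R = \<lparr>carrier = insert None (Some ` carrier R),
     monoid.mult = (\<lambda>x y. case x of None \<Rightarrow> y
        | Some a \<Rightarrow> (case y of None \<Rightarrow> Some a | Some b \<Rightarrow> Some (a \<otimes>\<^bsub>R\<^esub> b))),
     one = None\<rparr>"

definition nonempty_prod :: "('a, 'm) ring_scheme \<Rightarrow> ('i \<Rightarrow> 'a) \<Rightarrow> 'i set \<Rightarrow> 'a" where
  "nonempty_prod R e J = the (finprod (adjoin_one R) (\<lambda>j. Some (e j)) J)"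

definition big_vee :: "('a, 'm) ring_scheme \<Rightarrow> ('i \<Rightarrow> 'a) \<Rightarrow> 'i set \<Rightarrow> 'a" where
  "big_vee R e J =
     finsum R (\<lambda>J'. add_pow R ((-1 :: int) ^ (card J' - 1)) (nonempty_prod R e J'))
       {J'. J' \<noteq> {} \<and> J' \<subseteq> J}"

definition totally_disconnected_space :: "'w topology \<Rightarrow> bool" where
  "totally_disconnected_space X \<longleftrightarrow> (\<forall>x\<in>topspace X. connected_component_of_set X x = {x})"

text \<open>Functions are normalised to be \<open>0\<close> off \<^term>\<open>topspace X\<close>.\<close>

definition C0_int :: "'w topology \<Rightarrow> ('w \<Rightarrow> int) ring" where
  "C0_int X = \<lparr>carrier = {f. continuous_map X (discrete_topology UNIV) f \<and>
        compactin X (X closure_of {x \<in> topspace X. f x \<noteq> 0}) \<and>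
        (\<forall>x. x \<notin> topspace X \<longrightarrow> f x = 0)},
     monoid.mult = (\<lambda>f g x. f x * g x), one = undefined,
     ring.zero = (\<lambda>x. 0), ring.add = (\<lambda>f g x. f x + g x)\<rparr>"

record 'a semilat = "'a partial_object" +
  sprod :: "'a \<Rightarrow> 'a \<Rightarrow> 'a" (infixl \<open>\<odot>\<index>\<close> 70)
  szero :: 'a

locale zero_semilattice =
  fixes E :: "'a semilat" (structure)
  assumes closed: "\<lbrakk>e \<in> carrier E; f \<in> carrier E\<rbrakk> \<Longrightarrow> e \<odot> f \<in> carrier E"
    and assoc: "\<lbrakk>e \<in> carrier E; f \<in> carrier E; g \<in> carrier E\<rbrakk> \<Longrightarrow> (e \<odot> f) \<odot> g = e \<odot> (f \<odot> g)"
    and comm: "\<lbrakk>e \<in> carrier E; f \<in> carrier E\<rbrakk> \<Longrightarrow> e \<odot> f = f \<odot> e"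
    and idem: "e \<in> carrier E \<Longrightarrow> e \<odot> e = e"
    and zero_closed: "szero E \<in> carrier E"
    and zero: "e \<in> carrier E \<Longrightarrow> szero E \<odot> e = szero E"

definition nonzero :: "'a semilat \<Rightarrow> 'a set" where
  "nonzero E = carrier E - {szero E}"

definition slat_less :: "'a semilat \<Rightarrow> 'a \<Rightarrow> 'a \<Rightarrow> bool" where
  "slat_less E e f \<longleftrightarrow> e \<odot>\<^bsub>E\<^esub> f = e \<and> e \<noteq> f"

definition ZE :: "'a semilat \<Rightarrow> ('a \<Rightarrow>\<^sub>0 int) ring" where
  "ZE E = \<lparr>carrier = carrier (free_Abelian_group (nonzero E)),
     monoid.mult = (\<lambda>p q. frag_extend (\<lambda>e. frag_extend
        (\<lambda>f. if e \<odot>\<^bsub>E\<^esub> f \<noteq> szero E then frag_of (e \<odot>\<^bsub>E\<^esub> f) else 0) q) p),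
     one = undefined, ring.zero = 0, ring.add = (+)\<rparr>"

definition alg_action ::
  "('g, 'l) monoid_scheme \<Rightarrow> ('a, 'm) ring_scheme \<Rightarrow> ('g \<Rightarrow> 'a \<Rightarrow> 'a) \<Rightarrow> bool" where
  "alg_action \<Gamma> R \<alpha> \<longleftrightarrow> group_action \<Gamma> (carrier R) \<alpha> \<and> (\<forall>g\<in>carrier \<Gamma>. \<alpha> g \<in> alg_hom R R)"

definition Gamma_semilattice ::
  "('g, 'l) monoid_scheme \<Rightarrow> 'a semilat \<Rightarrow> ('g \<Rightarrow> 'a \<Rightarrow> 'a) \<Rightarrow> bool" where
  "Gamma_semilattice \<Gamma> E \<beta> \<longleftrightarrow> zero_semilattice E \<and> group_action \<Gamma> (carrier E) \<beta> \<and>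
     (\<forall>g\<in>carrier \<Gamma>. \<forall>e\<in>carrier E. \<forall>f\<in>carrier E. \<beta> g (e \<odot>\<^bsub>E\<^esub> f) = \<beta> g e \<odot>\<^bsub>E\<^esub> \<beta> g f)"

text \<open>Restricted to the carrier, because \<^const>\<open>group_action\<close> demands extensional functions.\<close>

definition ZE_action :: "'a semilat \<Rightarrow> ('g \<Rightarrow> 'a \<Rightarrow> 'a) \<Rightarrow> 'g \<Rightarrow> ('a \<Rightarrow>\<^sub>0 int) \<Rightarrow> ('a \<Rightarrow>\<^sub>0 int)" where
  "ZE_action E \<beta> g = (\<lambda>p\<in>carrier (ZE E). frag_extend (\<lambda>e. frag_of (\<beta> g e)) p)"

definition equivariant ::
  "('g, 'l) monoid_scheme \<Rightarrow> 'a set \<Rightarrow> ('g \<Rightarrow> 'a \<Rightarrow> 'a) \<Rightarrow> ('g \<Rightarrow> 'b \<Rightarrow> 'b) \<Rightarrow> ('a \<Rightarrow> 'b) \<Rightarrow> bool" where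
  "equivariant \<Gamma> A a b h \<longleftrightarrow> (\<forall>g\<in>carrier \<Gamma>. \<forall>x\<in>A. h (a g x) = b g (h x))"

definition acts_freely_on_nonzero ::
  "('g, 'l) monoid_scheme \<Rightarrow> 'a semilat \<Rightarrow> ('g \<Rightarrow> 'a \<Rightarrow> 'a) \<Rightarrow> bool" where
  "acts_freely_on_nonzero \<Gamma> E \<beta> \<longleftrightarrow> (\<forall>e\<in>nonzero E. stabilizer \<Gamma> \<beta> e = {\<one>\<^bsub>\<Gamma>\<^esub>})"

definition torsion_free_group :: "('g, 'l) monoid_scheme \<Rightarrow> bool" where
  "torsion_free_group \<Gamma> \<longleftrightarrow>
     (\<forall>g\<in>carrier \<Gamma>. \<forall>n::nat. n > 0 \<longrightarrow> g [^]\<^bsub>\<Gamma>\<^esub> n = \<one>\<^bsub>\<Gamma>\<^esub> \<longrightarrow> g = \<one>\<^bsub>\<Gamma>\<^esub>)"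

definition equivariant_surjection ::
  "('g, 'l) monoid_scheme \<Rightarrow> ('d, 'm) ring_scheme \<Rightarrow> ('g \<Rightarrow> 'd \<Rightarrow> 'd) \<Rightarrow>
   'a semilat \<Rightarrow> ('g \<Rightarrow> 'a \<Rightarrow> 'a) \<Rightarrow> (('a \<Rightarrow>\<^sub>0 int) \<Rightarrow> 'd) \<Rightarrow> bool" where
  "equivariant_surjection \<Gamma> D \<alpha> E \<beta> \<phi> \<longleftrightarrow>
     Gamma_semilattice \<Gamma> E \<beta> \<and> \<phi> \<in> alg_hom (ZE E) D \<and>
     equivariant \<Gamma> (carrier (ZE E)) (ZE_action E \<beta>) \<alpha> \<phi> \<and>
     \<phi> ` carrier (ZE E) = carrier D"

text \<open>Finite index sets \<open>J\<close> are taken, without loss of generality, to be sets of natural numbers.\<close>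

definition E_phi :: "('d, 'm) ring_scheme \<Rightarrow> 'a semilat \<Rightarrow> (('a \<Rightarrow>\<^sub>0 int) \<Rightarrow> 'd) \<Rightarrow> ('a \<Rightarrow>\<^sub>0 int) semilat" where
  "E_phi D E \<phi> = \<lparr>carrier =
       {frag_of e \<ominus>\<^bsub>ZE E\<^esub> big_vee (ZE E) (\<lambda>j. frag_of (f j)) J | e f (J :: nat set).
          finite J \<and> e \<in> nonzero E \<and> (\<forall>j\<in>J. f j \<in> nonzero E \<and> slat_less E (f j) e) \<and>
          \<phi> (frag_of e) = big_vee D (\<lambda>j. \<phi> (frag_of (f j))) J}
       \<union> {\<zero>\<^bsub>ZE E\<^esub>},
     sprod = (\<otimes>\<^bsub>ZE E\<^esub>), szero = \<zero>\<^bsub>ZE E\<^esub>\<rparr>"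

definition E_phi_action ::
  "('d, 'm) ring_scheme \<Rightarrow> 'a semilat \<Rightarrow> (('a \<Rightarrow>\<^sub>0 int) \<Rightarrow> 'd) \<Rightarrow>
   ('g \<Rightarrow> 'a \<Rightarrow> 'a) \<Rightarrow> 'g \<Rightarrow> ('a \<Rightarrow>\<^sub>0 int) \<Rightarrow> ('a \<Rightarrow>\<^sub>0 int)" where
  "E_phi_action D E \<phi> \<beta> g = restrict (ZE_action E \<beta> g) (carrier (E_phi D E \<phi>))"

text \<open>
  The sequence is \<open>\<dots> \<rightarrow> \<int>[E\<^sub>2\<^sup>\<times>] \<rightarrow> \<int>[E\<^sub>1\<^sup>\<times>] \<rightarrow> \<int>[E\<^sub>0\<^sup>\<times>] \<rightarrow> D \<rightarrow> 0\<close>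
  with last map \<open>\<epsilon>\<close> and with \<open>\<delta> k : \<int>[E\<^sub>k\<^sub>+\<^sub>1\<^sup>\<times>] \<rightarrow> \<int>[E\<^sub>k\<^sup>\<times>]\<close>.
\<close>

definition algebraic_independent_resolution ::
  "('g, 'l) monoid_scheme \<Rightarrow> ('d, 'm) ring_scheme \<Rightarrow> ('g \<Rightarrow> 'd \<Rightarrow> 'd) \<Rightarrow>
   (nat \<Rightarrow> 'a semilat) \<Rightarrow> (nat \<Rightarrow> 'g \<Rightarrow> 'a \<Rightarrow> 'a) \<Rightarrow>
   (('a \<Rightarrow>\<^sub>0 int) \<Rightarrow> 'd) \<Rightarrow> (nat \<Rightarrow> ('a \<Rightarrow>\<^sub>0 int) \<Rightarrow> ('a \<Rightarrow>\<^sub>0 int)) \<Rightarrow> bool" where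
  "algebraic_independent_resolution \<Gamma> D \<alpha> E \<beta> \<epsilon> \<delta> \<longleftrightarrow>
     (\<forall>k. Gamma_semilattice \<Gamma> (E k) (\<beta> k)) \<and>
     \<epsilon> \<in> alg_hom (ZE (E 0)) D \<and>
     equivariant \<Gamma> (carrier (ZE (E 0))) (ZE_action (E 0) (\<beta> 0)) \<alpha> \<epsilon> \<and>
     (\<forall>k. \<delta> k \<in> alg_hom (ZE (E (Suc k))) (ZE (E k)) \<and>
          equivariant \<Gamma> (carrier (ZE (E (Suc k))))
            (ZE_action (E (Suc k)) (\<beta> (Suc k))) (ZE_action (E k) (\<beta> k)) (\<delta> k)) \<and>
     \<epsilon> ` carrier (ZE (E 0)) = carrier D \<and>
     \<delta> 0 ` carrier (ZE (E 1)) = a_kernel (ZE (E 0)) D \<epsilon> \<and>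
     (\<forall>k. \<delta> (Suc k) ` carrier (ZE (E (Suc (Suc k)))) = a_kernel (ZE (E (Suc k))) (ZE (E k)) (\<delta> k))"

text \<open>
  As \<open>E\<^sub>k\<^sub>+\<^sub>1\<close> consists of elements of \<open>\<int>[E\<^sub>k\<^sup>\<times>]\<close>, the literal recursion would change the type at
  each step. All levels are therefore placed in one type: \<^term>\<open>Base e\<close> is an element \<open>e\<close> of
  \<open>E\<^sub>0\<close>, and \<^term>\<open>Comb G\<close> is the finitely supported function on the previous level whose graph
  over its support is \<open>G\<close>. Both \<^term>\<open>Base\<close> and \<open>encode\<close> are injective, so they only rename
  the elements of \<open>E\<close> and of \<open>(E\<^sub>k)\<^bsub>\<phi>\<^sub>k\<^esub>\<close>.
\<close>

datatype 'e tower = Base (unBase: 'e) | Comb "('e tower \<times> int) fset"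

definition encode :: "('e tower \<Rightarrow>\<^sub>0 int) \<Rightarrow> 'e tower" where
  "encode p = Comb (Abs_fset ((\<lambda>x. (x, Poly_Mapping.lookup p x)) ` Poly_Mapping.keys p))"

lemma inj_encode: "inj encode"
proof (rule injI)
  fix p q :: "'e tower \<Rightarrow>\<^sub>0 int"
  let ?G = "\<lambda>p. (\<lambda>x. (x, Poly_Mapping.lookup p x)) ` Poly_Mapping.keys p"
  assume "encode p = encode q"
  then have "Abs_fset (?G p) = Abs_fset (?G q)"
    unfolding encode_def by (rule tower.inject(2)[THEN iffD1])
  moreover have "finite (?G p)" "finite (?G q)"
    by (rule finite_imageI, rule finite_keys)+
  ultimately have eq: "?G p = ?G q"
    by (metis Abs_fset_inverse mem_Collect_eq)
  have "Poly_Mapping.lookup p x = Poly_Mapping.lookup q x" for x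
  proof (cases "x \<in> Poly_Mapping.keys p \<or> x \<in> Poly_Mapping.keys q")
    case True
    then have "(x, Poly_Mapping.lookup p x) \<in> ?G q \<or> (x, Poly_Mapping.lookup q x) \<in> ?G p"
      using eq by blast
    then show ?thesis by (elim disjE imageE) simp_all
  next
    case False
    then show ?thesis by (simp add: in_keys_iff)
  qed
  then show "p = q" by (rule poly_mapping_eqI)
qed

definition decode :: "'e tower \<Rightarrow> ('e tower \<Rightarrow>\<^sub>0 int)" where
  "decode = inv_into UNIV encode"

lemma decode_encode [simp]: "decode (encode p) = p"
  by (simp add: decode_def inj_encode)

definition rename :: "('a \<Rightarrow> 'b) \<Rightarrow> 'a semilat \<Rightarrow> 'b semilat" where
  "rename r E = \<lparr>carrier = r ` carrier E,
     sprod = (\<lambda>x y. r (inv_into (carrier E) r x \<odot>\<^bsub>E\<^esub> inv_into (carrier E) r y)),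
     szero = r (szero E)\<rparr>"

definition rename_action :: "('a \<Rightarrow> 'b) \<Rightarrow> 'a semilat \<Rightarrow> ('g \<Rightarrow> 'a \<Rightarrow> 'a) \<Rightarrow> 'g \<Rightarrow> 'b \<Rightarrow> 'b" where
  "rename_action r E \<beta> g = (\<lambda>x\<in>r ` carrier E. r (\<beta> g (inv_into (carrier E) r x)))"

text \<open>\<open>res_eps \<phi>\<close> is \<open>\<phi>\<^sub>0\<close>, and \<open>res_delta\<close> is \<open>\<phi>\<^sub>k\<^sub>+\<^sub>1\<close> for every \<open>k\<close>: it is the additive
  extension of the inclusion \<open>E\<^sub>k\<^sub>+\<^sub>1 \<hookrightarrow> \<int>[E\<^sub>k\<^sup>\<times>]\<close>, which is \<^const>\<open>decode\<close> at each level.\<close>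

definition res_eps :: "(('e \<Rightarrow>\<^sub>0 int) \<Rightarrow> 'd) \<Rightarrow> ('e tower \<Rightarrow>\<^sub>0 int) \<Rightarrow> 'd" where
  "res_eps \<phi> p = \<phi> (frag_extend (\<lambda>x. frag_of (unBase x)) p)"

definition res_delta :: "('e tower \<Rightarrow>\<^sub>0 int) \<Rightarrow> ('e tower \<Rightarrow>\<^sub>0 int)" where
  "res_delta = frag_extend decode"

fun res_E :: "('d, 'm) ring_scheme \<Rightarrow> 'e semilat \<Rightarrow> (('e \<Rightarrow>\<^sub>0 int) \<Rightarrow> 'd) \<Rightarrow> nat \<Rightarrow> 'e tower semilat" where
  "res_E D E \<phi> 0 = rename Base E"
| "res_E D E \<phi> (Suc 0) = rename encode (E_phi D (res_E D E \<phi> 0) (res_eps \<phi>))"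
| "res_E D E \<phi> (Suc (Suc k)) =
     rename encode (E_phi (ZE (res_E D E \<phi> k)) (res_E D E \<phi> (Suc k)) res_delta)"

fun res_action ::
  "('d, 'm) ring_scheme \<Rightarrow> 'e semilat \<Rightarrow> (('e \<Rightarrow>\<^sub>0 int) \<Rightarrow> 'd) \<Rightarrow> ('g \<Rightarrow> 'e \<Rightarrow> 'e) \<Rightarrow>
   nat \<Rightarrow> 'g \<Rightarrow> 'e tower \<Rightarrow> 'e tower" where
  "res_action D E \<phi> \<beta> 0 = rename_action Base E \<beta>"
| "res_action D E \<phi> \<beta> (Suc 0) =
     rename_action encode (E_phi D (res_E D E \<phi> 0) (res_eps \<phi>))
       (E_phi_action D (res_E D E \<phi> 0) (res_eps \<phi>) (res_action D E \<phi> \<beta> 0))"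
| "res_action D E \<phi> \<beta> (Suc (Suc k)) =
     rename_action encode (E_phi (ZE (res_E D E \<phi> k)) (res_E D E \<phi> (Suc k)) res_delta)
       (E_phi_action (ZE (res_E D E \<phi> k)) (res_E D E \<phi> (Suc k)) res_delta
          (res_action D E \<phi> \<beta> (Suc k)))"

end

theory Submission
  imports Defs
begin

text \<open>
  Both \<open>D\<close> and every \<open>\<int>[E\<^sup>\<times>]\<close> are algebras of integer-valued functions: for \<open>\<int>[E\<^sup>\<times>]\<close> the characters
  \<open>e \<mapsto> [x \<le> e]\<close> with \<open>x \<in> E\<^sup>\<times>\<close> separate points, because a non-zero combination does not vanish
  at a maximal element of its support. Identities can therefore be checked on characters, where
  \<open>e - \<Or>e\<^sub>j\<close> becomes the indicator of a difference of sets.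

  For exactness, let \<open>\<phi> p = 0\<close>, let \<open>U\<close> be a finite subsemilattice containing the support of \<open>p\<close>,
  \<open>e\<close> a maximal element of \<open>U\<close> with coefficient \<open>n \<noteq> 0\<close> in \<open>p\<close>, and \<open>q = e - \<Or>{u \<in> U. u < e}\<close>. Then
  \<open>p q = n q\<close>, so \<open>n \<phi>(q) = 0\<close> and hence \<open>q \<in> E\<^sub>\<phi>\<close>; as \<open>p - n q\<close> is supported on the smaller
  semilattice \<open>U - {e}\<close>, induction shows that \<open>p\<close> is in the span of \<open>E\<^sub>\<phi>\<close>.

  For \<open>E\<close> one can take the idempotents of \<open>D\<close>. If \<open>\<Gamma>\<close> is torsion-free, pair them with the finite
  non-empty subsets of \<open>\<Gamma>\<close>, multiplied by union; such a subset has trivial stabilizer. Freeness passes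
  from \<open>E\<close> to \<open>E\<^sub>\<phi>\<close> since \<open>e\<close> is the largest element in the support of \<open>e - \<Or>e\<^sub>j\<close>.
\<close>

section \<open>Algebras of integer-valued functions\<close>

definition characters :: "('a, 'm) ring_scheme \<Rightarrow> ('a \<Rightarrow> int) set" where
  "characters R = {\<kappa>. \<forall>x\<in>carrier R. \<forall>y\<in>carrier R.
     \<kappa> (x \<oplus>\<^bsub>R\<^esub> y) = \<kappa> x + \<kappa> y \<and> \<kappa> (x \<otimes>\<^bsub>R\<^esub> y) = \<kappa> x * \<kappa> y}"

lemma character_add:
  "\<lbrakk>\<kappa> \<in> characters R; x \<in> carrier R; y \<in> carrier R\<rbrakk> \<Longrightarrow> \<kappa> (x \<oplus>\<^bsub>R\<^esub> y) = \<kappa> x + \<kappa> y"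
  by (simp add: characters_def)

lemma character_mult:
  "\<lbrakk>\<kappa> \<in> characters R; x \<in> carrier R; y \<in> carrier R\<rbrakk> \<Longrightarrow> \<kappa> (x \<otimes>\<^bsub>R\<^esub> y) = \<kappa> x * \<kappa> y"
  by (simp add: characters_def)

lemma alg_hom_closed: "\<lbrakk>h \<in> alg_hom R S; x \<in> carrier R\<rbrakk> \<Longrightarrow> h x \<in> carrier S"
  by (auto simp: alg_hom_def)

lemma alg_hom_mult:
  "\<lbrakk>h \<in> alg_hom R S; x \<in> carrier R; y \<in> carrier R\<rbrakk> \<Longrightarrow> h (x \<otimes>\<^bsub>R\<^esub> y) = h x \<otimes>\<^bsub>S\<^esub> h y"
  by (auto simp: alg_hom_def)

lemma character_comp_alg_hom:
  "\<lbrakk>h \<in> alg_hom R S; \<kappa> \<in> characters S\<rbrakk> \<Longrightarrow> (\<lambda>x. \<kappa> (h x)) \<in> characters R"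
  by (auto simp: alg_hom_def characters_def Pi_iff)

context abelian_group
begin

lemma character_zero: "\<kappa> \<in> characters G \<Longrightarrow> \<kappa> \<zero> = 0"
  using character_add[of \<kappa> G \<zero> \<zero>] by simp

lemma character_uminus: "\<lbrakk>\<kappa> \<in> characters G; x \<in> carrier G\<rbrakk> \<Longrightarrow> \<kappa> (\<ominus> x) = - \<kappa> x"
  using character_add[of \<kappa> G x "\<ominus> x"] by (simp add: r_neg character_zero)

lemma character_minus:
  "\<lbrakk>\<kappa> \<in> characters G; x \<in> carrier G; y \<in> carrier G\<rbrakk> \<Longrightarrow> \<kappa> (x \<ominus> y) = \<kappa> x - \<kappa> y"
  by (simp add: a_minus_def character_add character_uminus)

lemma character_add_pow_nat:
  "\<lbrakk>\<kappa> \<in> characters G; x \<in> carrier G\<rbrakk> \<Longrightarrow> \<kappa> (add_pow G (n::nat) x) = int n * \<kappa> x"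
  by (induction n) (auto simp: character_zero character_add algebra_simps)

lemma character_add_pow_int:
  "\<lbrakk>\<kappa> \<in> characters G; x \<in> carrier G\<rbrakk> \<Longrightarrow> \<kappa> (add_pow G (k::int) x) = k * \<kappa> x"
  by (cases "k \<ge> 0")
    (auto simp: add_pow_int_ge add_pow_int_lt character_uminus character_add_pow_nat)

lemma character_finsum:
  assumes "\<kappa> \<in> characters G" "f \<in> A \<rightarrow> carrier G" "finite A"
  shows "\<kappa> (finsum G f A) = (\<Sum>a\<in>A. \<kappa> (f a))"
  using assms(3,2)
  by (induction A) (auto simp: assms(1) character_zero character_add Pi_iff)

end

text \<open>Algebras of integer-valued functions, without reference to a particular embedding.\<close>

locale function_algebra = z_algebra +
  assumes separated:
    "\<lbrakk>x \<in> carrier R; y \<in> carrier R; \<And>\<kappa>. \<kappa> \<in> characters R \<Longrightarrow> \<kappa> x = \<kappa> y\<rbrakk> \<Longrightarrow> x = y"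
begin

lemma m_comm: "\<lbrakk>x \<in> carrier R; y \<in> carrier R\<rbrakk> \<Longrightarrow> x \<otimes> y = y \<otimes> x"
  by (rule separated) (auto simp: m_closed character_mult)

text \<open>Preservation of zero is not a clause of \<open>alg_hom\<close>; it follows from
  additivity, checked on the characters of the target.\<close>

lemma alg_hom_zero:
  assumes "abelian_group S" "h \<in> alg_hom S R"
  shows "h \<zero>\<^bsub>S\<^esub> = \<zero>"
proof (rule separated)
  interpret S: abelian_group S by fact
  show "h \<zero>\<^bsub>S\<^esub> \<in> carrier R" using assms by (auto intro: alg_hom_closed)
  fix \<kappa> assume "\<kappa> \<in> characters R"
  then show "\<kappa> (h \<zero>\<^bsub>S\<^esub>) = \<kappa> \<zero>"
    using S.character_zero[OF character_comp_alg_hom[OF assms(2)]] by (simp add: character_zero)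
qed simp

lemma character_idem:
  assumes "\<kappa> \<in> characters R" "e \<in> carrier R" "e \<otimes> e = e"
  shows "\<kappa> e = 0 \<or> \<kappa> e = 1"
  using character_mult[OF assms(1,2,2)] assms(3) by auto

section \<open>Finite products and joins, evaluated by characters\<close>

lemma adjoin_one_simps [simp]:
  "None \<in> carrier (adjoin_one R)" "Some x \<in> carrier (adjoin_one R) \<longleftrightarrow> x \<in> carrier R"
  "\<one>\<^bsub>adjoin_one R\<^esub> = None" "None \<otimes>\<^bsub>adjoin_one R\<^esub> u = u" "u \<otimes>\<^bsub>adjoin_one R\<^esub> None = u"
  "Some x \<otimes>\<^bsub>adjoin_one R\<^esub> Some y = Some (x \<otimes> y)"
  by (auto simp: adjoin_one_def split: option.split)

text \<open>Makes the rules for \<open>finprod\<close> available to \<open>nonempty_prod\<close>.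
  Commutativity comes from \<open>m_comm\<close>, hence from separation by characters.\<close>

lemma adjoin_one_comm_monoid: "comm_monoid (adjoin_one R)"
proof (rule comm_monoidI)
  fix x y z
  assume "x \<in> carrier (adjoin_one R)" "y \<in> carrier (adjoin_one R)"
  then show "x \<otimes>\<^bsub>adjoin_one R\<^esub> y \<in> carrier (adjoin_one R)"
    "x \<otimes>\<^bsub>adjoin_one R\<^esub> y = y \<otimes>\<^bsub>adjoin_one R\<^esub> x"
    by (cases x; cases y; simp add: m_closed m_comm)+
  assume "z \<in> carrier (adjoin_one R)"
  with \<open>x \<in> _\<close> \<open>y \<in> _\<close>
  show "x \<otimes>\<^bsub>adjoin_one R\<^esub> y \<otimes>\<^bsub>adjoin_one R\<^esub> z =
      x \<otimes>\<^bsub>adjoin_one R\<^esub> (y \<otimes>\<^bsub>adjoin_one R\<^esub> z)"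
    by (cases x; cases y; cases z; simp add: m_assoc)
qed simp_all

text \<open>The \<open>the\<close> in \<open>nonempty_prod\<close> is harmless: over a non-empty set
  the product in the unitised monoid lies in the image of \<open>Some\<close>, by induction on the
  set.\<close>

lemma nonempty_prod_insert:
  assumes "finite J" "e ` J \<subseteq> carrier R" "J \<noteq> {}" "i \<notin> J" "e i \<in> carrier R"
  shows "nonempty_prod R e (insert i J) = e i \<otimes> nonempty_prod R e J"
    and "nonempty_prod R e J \<in> carrier R"
proof -
  interpret A: comm_monoid "adjoin_one R" by (rule adjoin_one_comm_monoid)
  have some: "(\<lambda>j. Some (e j)) \<in> J \<rightarrow> carrier (adjoin_one R)"
    "Some (e i) \<in> carrier (adjoin_one R)"
    using assms by auto
  have "finprod (adjoin_one R) (\<lambda>j. Some (e j)) J \<in> Some ` carrier R"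
    using assms(1,3,2)
  proof (induction rule: finite_ne_induct)
    case (singleton j)
    then show ?case
      by (subst A.finprod_insert) auto
  next
    case (insert j F)
    then show ?case
      by (subst A.finprod_insert) (auto simp: m_closed)
  qed
  then obtain x where x: "finprod (adjoin_one R) (\<lambda>j. Some (e j)) J = Some x" "x \<in> carrier R"
    by auto
  show "nonempty_prod R e (insert i J) = e i \<otimes> nonempty_prod R e J"
    using A.finprod_insert[OF assms(1,4) some] x
    by (simp add: nonempty_prod_def)
  show "nonempty_prod R e J \<in> carrier R"
    using x by (simp add: nonempty_prod_def)
qed

lemma nonempty_prod_singleton:
  assumes "e i \<in> carrier R"
  shows "nonempty_prod R e {i} = e i"
proof -
  interpret A: comm_monoid "adjoin_one R" by (rule adjoin_one_comm_monoid)
  show ?thesis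
    using assms A.finprod_insert[of "{}" i "\<lambda>j. Some (e j)"]
    by (simp add: nonempty_prod_def)
qed

lemma nonempty_prod_character:
  assumes "finite J" "J \<noteq> {}" "e ` J \<subseteq> carrier R"
  shows "nonempty_prod R e J \<in> carrier R \<and>
    (\<forall>\<kappa>\<in>characters R. \<kappa> (nonempty_prod R e J) = (\<Prod>j\<in>J. \<kappa> (e j)))"
  using assms
proof (induction rule: finite_ne_induct)
  case (singleton j)
  then show ?case by (simp add: nonempty_prod_singleton)
next
  case (insert j F)
  then show ?case
    by (simp add: nonempty_prod_insert(1) m_closed character_mult)
qed

end

text \<open>Expand the product of the factors \<open>1 - a j\<close> over all subsets of
  \<open>J\<close>. The empty subset contributes 1, and every other one its product with the
  opposite of the sign on the left.\<close>

lemma inclusion_exclusion_prod: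
  fixes a :: "'i \<Rightarrow> 'c::comm_ring_1"
  assumes "finite J"
  shows "(\<Sum>J'\<in>{J'. J' \<noteq> {} \<and> J' \<subseteq> J}. (-1) ^ (card J' - 1) * prod a J') = 1 - (\<Prod>j\<in>J. 1 - a j)"
proof -
  have *: "(-1) ^ (card J' - 1) * prod a J' = - (\<Prod>j\<in>J'. - a j)"
    if J': "J' \<noteq> {}" "J' \<subseteq> J" for J'
  proof -
    \<comment> \<open>The subtraction in \<open>card J' - 1\<close> is truncated; it is a true
      predecessor because \<open>J'\<close> is finite and non-empty.\<close>
    obtain n where "card J' = Suc n"
      using J' finite_subset[OF J'(2) assms] by (cases "card J'") auto
    then show ?thesis by (simp add: prod_uminus)
  qed
  have "(\<Prod>j\<in>J. 1 - a j) = (\<Sum>J'\<in>Pow J. (\<Prod>j\<in>J'. - a j))"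
    using prod_add[OF assms, of "\<lambda>j. - a j" "\<lambda>_. 1"] by (simp add: algebra_simps)
  also have "Pow J = insert {} {J'. J' \<noteq> {} \<and> J' \<subseteq> J}" by auto
  also have "(\<Sum>J'\<in>\<dots>. (\<Prod>j\<in>J'. - a j)) = 1 + (\<Sum>J'\<in>{J'. J' \<noteq> {} \<and> J' \<subseteq> J}. (\<Prod>j\<in>J'. - a j))"
    using assms by (subst sum.insert) auto
  finally have "(\<Prod>j\<in>J. 1 - a j) = 1 + (\<Sum>J'\<in>{J'. J' \<noteq> {} \<and> J' \<subseteq> J}. (\<Prod>j\<in>J'. - a j))" .
  moreover have "(\<Sum>J'\<in>{J'. J' \<noteq> {} \<and> J' \<subseteq> J}. (-1) ^ (card J' - 1) * prod a J') =
      - (\<Sum>J'\<in>{J'. J' \<noteq> {} \<and> J' \<subseteq> J}. (\<Prod>j\<in>J'. - a j))"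
    unfolding sum_negf[symmetric] by (intro sum.cong refl *) auto
  ultimately show ?thesis by simp
qed

context function_algebra
begin

text \<open>A character turns the defining alternating sum into inclusion-exclusion over the
  integers. When the values are 0 and 1 the result is the indicator of a union.\<close>

lemma big_vee_character:
  assumes "finite J" "e ` J \<subseteq> carrier R"
  shows big_vee_closed: "big_vee R e J \<in> carrier R"
    and character_big_vee:
      "\<kappa> \<in> characters R \<Longrightarrow> \<kappa> (big_vee R e J) = 1 - (\<Prod>j\<in>J. 1 - \<kappa> (e j))"
proof -
  let ?S = "{J'. J' \<noteq> {} \<and> J' \<subseteq> J}"
  have prod: "nonempty_prod R e J' \<in> carrier R"
    "\<kappa> \<in> characters R \<Longrightarrow> \<kappa> (nonempty_prod R e J') = (\<Prod>j\<in>J'. \<kappa> (e j))"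
    if "J' \<in> ?S" for J'
  proof -
    have "finite J'" "J' \<noteq> {}" "e ` J' \<subseteq> carrier R"
      using that assms by (auto intro: finite_subset)
    from nonempty_prod_character[OF this]
    show "nonempty_prod R e J' \<in> carrier R"
      "\<kappa> \<in> characters R \<Longrightarrow> \<kappa> (nonempty_prod R e J') = (\<Prod>j\<in>J'. \<kappa> (e j))" by auto
  qed
  have fin: "finite ?S" using assms(1) by simp
  have Pi: "(\<lambda>J'. add_pow R ((-1::int) ^ (card J' - 1)) (nonempty_prod R e J')) \<in> ?S \<rightarrow> carrier R"
    using prod(1) by auto
  show "big_vee R e J \<in> carrier R"
    unfolding big_vee_def by (rule finsum_closed[OF Pi])
  assume \<kappa>: "\<kappa> \<in> characters R"
  have "\<kappa> (big_vee R e J) = (\<Sum>J'\<in>?S. (-1) ^ (card J' - 1) * (\<Prod>j\<in>J'. \<kappa> (e j)))"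
    unfolding big_vee_def character_finsum[OF \<kappa> Pi fin]
    using prod(1) prod(2)[OF _ \<kappa>] by (intro sum.cong refl) (simp add: character_add_pow_int[OF \<kappa>])
  also have "\<dots> = 1 - (\<Prod>j\<in>J. 1 - \<kappa> (e j))"
    by (rule inclusion_exclusion_prod[OF assms(1)])
  finally show "\<kappa> (big_vee R e J) = 1 - (\<Prod>j\<in>J. 1 - \<kappa> (e j))" .
qed

text \<open>After applying a character this is the identity
  \<open>1 - (1 - a)(1 - b) = a + b - a b\<close>. It permits induction on the index set, as in
  \<open>keys_big_vee\<close>.\<close>

lemma big_vee_insert:
  assumes "finite J" "e ` J \<subseteq> carrier R" "i \<notin> J" "e i \<in> carrier R"
  shows "big_vee R e (insert i J) = (e i \<oplus> big_vee R e J) \<ominus> e i \<otimes> big_vee R e J"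
  using assms
proof (intro separated)
  have insert: "e ` insert i J \<subseteq> carrier R" "finite (insert i J)" using assms by auto
  note closed = big_vee_closed[OF assms(1,2)] big_vee_closed[OF insert(2,1)]
  show "big_vee R e (insert i J) \<in> carrier R" "(e i \<oplus> big_vee R e J) \<ominus> e i \<otimes> big_vee R e J \<in> carrier R"
    using assms closed by (simp_all add: m_closed)
  fix \<kappa> assume \<kappa>: "\<kappa> \<in> characters R"
  show "\<kappa> (big_vee R e (insert i J)) = \<kappa> ((e i \<oplus> big_vee R e J) \<ominus> e i \<otimes> big_vee R e J)"
    using assms(1,3,4) closed
    by (simp add: character_big_vee[OF insert(2,1) \<kappa>] character_big_vee[OF assms(1,2) \<kappa>] m_closed
      character_minus[OF \<kappa>] character_add[OF \<kappa>] character_mult[OF \<kappa>] algebra_simps)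
qed

lemma big_vee_empty: "big_vee R e {} = \<zero>"
  by (simp add: big_vee_def)

text \<open>Composing a character of \<open>R\<close> with \<open>h\<close> gives a character of
  \<open>S\<close>, so both sides are evaluated by the same product formula.\<close>

lemma alg_hom_big_vee:
  assumes "function_algebra S" "h \<in> alg_hom S R" "finite J" "e ` J \<subseteq> carrier S"
  shows "h (big_vee S e J) = big_vee R (\<lambda>j. h (e j)) J"
proof -
  interpret S: function_algebra S by fact
  have im: "(\<lambda>j. h (e j)) ` J \<subseteq> carrier R"
    using assms(2,4) alg_hom_closed[of h S R] by auto
  show ?thesis
  proof (rule separated)
    show "h (big_vee S e J) \<in> carrier R" "big_vee R (\<lambda>j. h (e j)) J \<in> carrier R"
      by (rule alg_hom_closed[OF assms(2) S.big_vee_closed[OF assms(3,4)]], rule big_vee_closed[OF assms(3) im])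
    fix \<kappa> assume \<kappa>: "\<kappa> \<in> characters R"
    show "\<kappa> (h (big_vee S e J)) = \<kappa> (big_vee R (\<lambda>j. h (e j)) J)"
      unfolding S.character_big_vee[OF assms(3,4) character_comp_alg_hom[OF assms(2) \<kappa>]]
        character_big_vee[OF assms(3) im \<kappa>] ..
  qed
qed

end

section \<open>The algebra of a semilattice\<close>

text \<open>Strengthens \<open>frag_induction\<close>: the difference case also provides the
  supports of both parts, which is obtained by carrying the support condition along in the
  induction.\<close>

lemma frag_induct_on [consumes 1, case_names zero one diff]:
  assumes "Poly_Mapping.keys p \<subseteq> S" "P 0" "\<And>e. e \<in> S \<Longrightarrow> P (frag_of e)"
    and "\<And>p q. \<lbrakk>Poly_Mapping.keys p \<subseteq> S; Poly_Mapping.keys q \<subseteq> S; P p; P q\<rbrakk> \<Longrightarrow> P (p - q)"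
  shows "P p"
proof -
  have "Poly_Mapping.keys p \<subseteq> S \<and> P p"
    using assms(1)
  proof (induction rule: frag_induction)
    case (diff p q)
    then show ?case using assms(4)[of p q] keys_diff[of p q] by blast
  qed (use assms in auto)
  then show ?thesis ..
qed

lemma frag_extend_diff_fun: "frag_extend (\<lambda>e. f e - g e) p = frag_extend f p - frag_extend g p"
  using subset_UNIV[of "Poly_Mapping.keys p"]
  by (induction p rule: frag_induct_on) (auto simp: frag_extend_diff)

lemma frag_extend_zero_fun: "frag_extend (\<lambda>e. 0) p = 0"
  using subset_UNIV[of "Poly_Mapping.keys p"]
  by (induction p rule: frag_induct_on) (auto simp: frag_extend_diff)

lemma frag_extend_cong_on: "\<lbrakk>Poly_Mapping.keys p \<subseteq> S; \<And>e. e \<in> S \<Longrightarrow> f e = g e\<rbrakk> \<Longrightarrow> frag_extend f p = frag_extend g p"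
  by (induction p rule: frag_induct_on) (auto simp: frag_extend_diff)

lemma ZE_simps [simp]:
  "carrier (ZE E) = {p. Poly_Mapping.keys p \<subseteq> nonzero E}"
  "\<zero>\<^bsub>ZE E\<^esub> = 0" "p \<oplus>\<^bsub>ZE E\<^esub> q = p + q"
  by (auto simp: ZE_def)

lemma abelian_group_ZE: "abelian_group (ZE E)"
proof (rule abelian_groupI)
  fix p assume p: "p \<in> carrier (ZE E)"
  then show "\<exists>q\<in>carrier (ZE E). q \<oplus>\<^bsub>ZE E\<^esub> p = \<zero>\<^bsub>ZE E\<^esub>"
    by (intro bexI[of _ "- p"]) auto
  fix q assume "q \<in> carrier (ZE E)"
  with p show "p \<oplus>\<^bsub>ZE E\<^esub> q \<in> carrier (ZE E)"
    using keys_add[of p q] by auto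
qed (auto simp: algebra_simps)

lemma ZE_uminus: "p \<in> carrier (ZE E) \<Longrightarrow> \<ominus>\<^bsub>ZE E\<^esub> p = - p"
  by (rule abelian_group.minus_equality[OF abelian_group_ZE]) auto

lemma ZE_minus: "q \<in> carrier (ZE E) \<Longrightarrow> p \<ominus>\<^bsub>ZE E\<^esub> q = p - q"
  by (simp add: a_minus_def ZE_uminus)

text \<open>The canonical map from the semilattice to its algebra, with zero sent to 0. Being
  multiplicative (\<open>basis_mult\<close>), it absorbs the case distinction in the product of
  basis elements.\<close>

definition basis :: "'a semilat \<Rightarrow> 'a \<Rightarrow> ('a \<Rightarrow>\<^sub>0 int)" where
  "basis E e = (if e = szero E then 0 else frag_of e)"

lemma basis_nonzero: "e \<in> nonzero E \<Longrightarrow> basis E e = frag_of e"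
  by (auto simp: nonzero_def basis_def)

lemma basis_closed: "e \<in> carrier E \<Longrightarrow> basis E e \<in> carrier (ZE E)"
  by (auto simp: nonzero_def basis_def)

lemma ZE_mult: "p \<otimes>\<^bsub>ZE E\<^esub> q = frag_extend (\<lambda>e. frag_extend (\<lambda>f. basis E (e \<odot>\<^bsub>E\<^esub> f)) q) p"
proof -
  have "(\<lambda>e f. if e \<odot>\<^bsub>E\<^esub> f \<noteq> szero E then frag_of (e \<odot>\<^bsub>E\<^esub> f) else 0) = (\<lambda>e f. basis E (e \<odot>\<^bsub>E\<^esub> f))"
    by (auto simp: basis_def fun_eq_iff)
  then show ?thesis by (simp add: ZE_def fun_eq_iff)
qed

lemma ZE_mult_zero [simp]: "0 \<otimes>\<^bsub>ZE E\<^esub> q = 0" "p \<otimes>\<^bsub>ZE E\<^esub> 0 = 0"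
  by (simp_all add: ZE_mult frag_extend_zero_fun)

lemma ZE_mult_diff:
  "(p - p') \<otimes>\<^bsub>ZE E\<^esub> q = p \<otimes>\<^bsub>ZE E\<^esub> q - p' \<otimes>\<^bsub>ZE E\<^esub> q"
  "p \<otimes>\<^bsub>ZE E\<^esub> (q - q') = p \<otimes>\<^bsub>ZE E\<^esub> q - p \<otimes>\<^bsub>ZE E\<^esub> q'"
  by (simp_all add: ZE_mult frag_extend_diff frag_extend_diff_fun)

lemma keys_basis: "Poly_Mapping.keys (basis E e) \<subseteq> {e} - {szero E}"
  by (auto simp: basis_def)

text \<open>Vanishing products drop out of the support, so closure of \<open>U\<close> is demanded
  for non-zero products only.\<close>

lemma keys_ZE_mult:
  assumes "Poly_Mapping.keys p \<subseteq> U" "Poly_Mapping.keys q \<subseteq> U"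
    and "\<And>e f. \<lbrakk>e \<in> U; f \<in> U\<rbrakk> \<Longrightarrow> e \<odot>\<^bsub>E\<^esub> f \<noteq> szero E \<Longrightarrow> e \<odot>\<^bsub>E\<^esub> f \<in> U"
  shows "Poly_Mapping.keys (p \<otimes>\<^bsub>ZE E\<^esub> q) \<subseteq> U"
proof
  fix x assume "x \<in> Poly_Mapping.keys (p \<otimes>\<^bsub>ZE E\<^esub> q)"
  then obtain e where e: "e \<in> Poly_Mapping.keys p"
    "x \<in> Poly_Mapping.keys (frag_extend (\<lambda>f. basis E (e \<odot>\<^bsub>E\<^esub> f)) q)"
    unfolding ZE_mult using keys_frag_extend by fastforce
  then obtain f where "f \<in> Poly_Mapping.keys q" "x \<in> Poly_Mapping.keys (basis E (e \<odot>\<^bsub>E\<^esub> f))"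
    using keys_frag_extend by fastforce
  moreover have "x = e \<odot>\<^bsub>E\<^esub> f" "x \<noteq> szero E"
    using calculation(2) keys_basis[of E "e \<odot>\<^bsub>E\<^esub> f"] by auto
  ultimately show "x \<in> U"
    using e(1) assms by blast
qed

text \<open>The linear extension of \<open>e \<mapsto> [x \<le> e]\<close>, realised as the
  coefficient at the only basis element of the free abelian group on the unit type.\<close>

definition cone_character :: "'a semilat \<Rightarrow> 'a \<Rightarrow> ('a \<Rightarrow>\<^sub>0 int) \<Rightarrow> int" where
  "cone_character E x p =
     Poly_Mapping.lookup (frag_extend (\<lambda>e. if x \<odot>\<^bsub>E\<^esub> e = x then frag_of () else 0) p) ()"

lemma cone_character_simps [simp]:
  "cone_character E x (p + q) = cone_character E x p + cone_character E x q"
  "cone_character E x (p - q) = cone_character E x p - cone_character E x q"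
  "cone_character E x 0 = 0"
  "cone_character E x (frag_of e) = (if x \<odot>\<^bsub>E\<^esub> e = x then 1 else 0)"
  by (simp_all add: cone_character_def frag_extend_add frag_extend_diff lookup_add lookup_minus)

context zero_semilattice
begin

lemma nonzero_closed: "e \<in> nonzero E \<Longrightarrow> e \<in> carrier E"
  by (simp add: nonzero_def)

lemma zero_right: "e \<in> carrier E \<Longrightarrow> e \<odot> szero E = szero E"
  using comm zero zero_closed by metis

lemma basis_mult:
  assumes "e \<in> carrier E" "f \<in> carrier E"
  shows "basis E e \<otimes>\<^bsub>ZE E\<^esub> basis E f = basis E (e \<odot> f)"
  using assms by (auto simp: basis_def ZE_mult zero zero_right)

lemma ZE_m_closed:
  "\<lbrakk>p \<in> carrier (ZE E); q \<in> carrier (ZE E)\<rbrakk> \<Longrightarrow> p \<otimes>\<^bsub>ZE E\<^esub> q \<in> carrier (ZE E)"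
  using keys_ZE_mult[of p "nonzero E" q E] closed by (auto simp: nonzero_def)

lemma ZE_diff_closed:
  "\<lbrakk>p \<in> carrier (ZE E); q \<in> carrier (ZE E)\<rbrakk> \<Longrightarrow> p - q \<in> carrier (ZE E)"
  using keys_diff[of p q] by auto

lemma additive_on_ZE:
  fixes T :: "('a \<Rightarrow>\<^sub>0 int) \<Rightarrow> 'b::ab_group_add"
  assumes add: "\<And>p q. \<lbrakk>p \<in> carrier (ZE E); q \<in> carrier (ZE E)\<rbrakk> \<Longrightarrow> T (p + q) = T p + T q"
  shows "T 0 = 0" "\<lbrakk>p \<in> carrier (ZE E); q \<in> carrier (ZE E)\<rbrakk> \<Longrightarrow> T (p - q) = T p - T q"
proof -
  show "T 0 = 0" using add[of 0 0] by simp
  assume "p \<in> carrier (ZE E)" "q \<in> carrier (ZE E)"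
  then show "T (p - q) = T p - T q"
    using add[of "p - q" q] ZE_diff_closed by (simp add: algebra_simps)
qed

text \<open>Bilinearity reduces the claim to basis elements: induction on the right factor with a
  basis element on the left, then induction on the left factor.\<close>

lemma multiplicative_on_ZE:
  fixes T :: "('a \<Rightarrow>\<^sub>0 int) \<Rightarrow> int"
  assumes add: "\<And>p q. \<lbrakk>p \<in> carrier (ZE E); q \<in> carrier (ZE E)\<rbrakk> \<Longrightarrow> T (p + q) = T p + T q"
    and mult: "\<And>e f. \<lbrakk>e \<in> nonzero E; f \<in> nonzero E\<rbrakk> \<Longrightarrow>
      T (basis E (e \<odot> f)) = T (frag_of e) * T (frag_of f)"
    and pq: "p \<in> carrier (ZE E)" "q \<in> carrier (ZE E)"
  shows "T (p \<otimes>\<^bsub>ZE E\<^esub> q) = T p * T q"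
proof -
  have T0: "T 0 = 0"
    by (rule additive_on_ZE(1), rule add)
  have Tdiff: "T (p - q) = T p - T q" if "p \<in> carrier (ZE E)" "q \<in> carrier (ZE E)" for p q
    by (rule additive_on_ZE(2)[OF _ that], rule add)
  have q: "T (frag_of e \<otimes>\<^bsub>ZE E\<^esub> q) = T (frag_of e) * T q" if e: "e \<in> nonzero E" for e
  proof -
    from pq(2) have "Poly_Mapping.keys q \<subseteq> nonzero E" by simp
    then show ?thesis
    proof (induction q rule: frag_induct_on)
      case zero
      then show ?case by (simp add: T0)
    next
      case (one f)
      with e show ?case
        using basis_mult[of e f] mult[of e f] by (simp add: basis_nonzero nonzero_closed)
    next
      case (diff q q')
      then have "frag_of e \<otimes>\<^bsub>ZE E\<^esub> q \<in> carrier (ZE E)" "frag_of e \<otimes>\<^bsub>ZE E\<^esub> q' \<in> carrier (ZE E)"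
        using e ZE_m_closed[of "frag_of e" q] ZE_m_closed[of "frag_of e" q'] by simp_all
      then show ?case
        using diff Tdiff[of q q'] Tdiff[of "frag_of e \<otimes>\<^bsub>ZE E\<^esub> q" "frag_of e \<otimes>\<^bsub>ZE E\<^esub> q'"]
        by (simp add: ZE_mult_diff left_diff_distrib right_diff_distrib)
    qed
  qed
  from pq(1) have "Poly_Mapping.keys p \<subseteq> nonzero E" by simp
  then show ?thesis
  proof (induction p rule: frag_induct_on)
    case zero
    then show ?case by (simp add: T0)
  next
    case (one e)
    then show ?case by (rule q)
  next
    case (diff p p')
    then have "p \<otimes>\<^bsub>ZE E\<^esub> q \<in> carrier (ZE E)" "p' \<otimes>\<^bsub>ZE E\<^esub> q \<in> carrier (ZE E)"
      using ZE_m_closed[of p q] ZE_m_closed[of p' q] pq(2) by simp_all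
    then show ?case
      using diff Tdiff[of p p'] Tdiff[of "p \<otimes>\<^bsub>ZE E\<^esub> q" "p' \<otimes>\<^bsub>ZE E\<^esub> q"]
      by (simp add: ZE_mult_diff left_diff_distrib right_diff_distrib)
  qed
qed

text \<open>The product is the meet for the order of the semilattice; this is what makes cone
  characters multiplicative.\<close>

lemma le_mult_iff:
  assumes "x \<in> carrier E" "e \<in> carrier E" "f \<in> carrier E"
  shows "x \<odot> (e \<odot> f) = x \<longleftrightarrow> x \<odot> e = x \<and> x \<odot> f = x"
proof
  assume x: "x \<odot> (e \<odot> f) = x"
  have ef: "(e \<odot> f) \<odot> f = e \<odot> f" "(e \<odot> f) \<odot> e = e \<odot> f"
    using assms by (metis assoc idem, metis assoc comm idem)
  have "x \<odot> ((e \<odot> f) \<odot> e) = x \<odot> e" "x \<odot> ((e \<odot> f) \<odot> f) = x \<odot> f"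
    using x assoc[OF assms(1) closed[OF assms(2,3)]] assms(2,3) by metis+
  then show "x \<odot> e = x \<and> x \<odot> f = x" using ef x by simp
next
  assume "x \<odot> e = x \<and> x \<odot> f = x"
  then show "x \<odot> (e \<odot> f) = x" using assoc[OF assms] by simp
qed

text \<open>That \<open>x\<close> is non-zero matters when \<open>e \<odot> f\<close> vanishes: an
  \<open>x\<close> below both factors is below their product, and no non-zero element is below
  zero.\<close>

lemma cone_character: "x \<in> nonzero E \<Longrightarrow> cone_character E x \<in> characters (ZE E)"
  unfolding characters_def
proof (intro CollectI ballI conjI)
  fix p q assume x: "x \<in> nonzero E" and "p \<in> carrier (ZE E)" "q \<in> carrier (ZE E)"
  then show "cone_character E x (p \<otimes>\<^bsub>ZE E\<^esub> q) = cone_character E x p * cone_character E x q"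
  proof (intro multiplicative_on_ZE)
    fix e f assume ef: "e \<in> nonzero E" "f \<in> nonzero E"
    show "cone_character E x (basis E (e \<odot> f)) = cone_character E x (frag_of e) * cone_character E x (frag_of f)"
      using x ef le_mult_iff[of x e f] zero_right[of x] by (auto simp: basis_def nonzero_def)
  qed auto
qed auto

text \<open>Take an element of \<open>K\<close> with the fewest elements of \<open>K\<close> above
  it. Anything in \<open>K\<close> above it has at most the same upper bounds in \<open>K\<close>,
  hence exactly the same ones, and antisymmetry gives equality.\<close>

lemma exists_maximal:
  assumes "finite K" "K \<noteq> {}" "K \<subseteq> carrier E"
  obtains e where "e \<in> K" "\<And>u. \<lbrakk>u \<in> K; e \<odot> u = e\<rbrakk> \<Longrightarrow> u = e"
proof -
  let ?c = "\<lambda>e. card {u \<in> K. e \<odot> u = e}"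
  obtain e where e: "e \<in> K" "\<And>u. u \<in> K \<Longrightarrow> ?c e \<le> ?c u"
    using ex_has_least_nat[of "\<lambda>x. x \<in> K" _ ?c] assms(2) by blast
  show thesis
  proof (rule that[OF e(1)])
    fix u assume u: "u \<in> K" "e \<odot> u = e"
    have C: "u \<in> carrier E" "e \<in> carrier E" using u e(1) assms(3) by auto
    have sub: "{v \<in> K. u \<odot> v = u} \<subseteq> {v \<in> K. e \<odot> v = e}"
    proof safe
      fix v assume "v \<in> K" "u \<odot> v = u"
      then show "e \<odot> v = e"
        using assoc[of e u v] C u(2) assms(3) by auto
    qed
    have "{v \<in> K. u \<odot> v = u} = {v \<in> K. e \<odot> v = e}"
      using e(2)[OF u(1)] assms(1) sub by (intro card_seteq) auto
    then have "u \<odot> e = u" using e(1) idem C by auto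
    then show "u = e" using u(2) comm C by metis
  qed
qed

lemma cone_characters_separate:
  assumes p: "p \<in> carrier (ZE E)" and zero: "\<And>x. x \<in> nonzero E \<Longrightarrow> cone_character E x p = 0"
  shows "p = 0"
proof (rule ccontr)
  assume "p \<noteq> 0"
  then obtain e where e: "e \<in> Poly_Mapping.keys p"
    and max: "\<And>u. u \<in> Poly_Mapping.keys p \<Longrightarrow> e \<odot> u = e \<Longrightarrow> u = e"
    using exists_maximal[of "Poly_Mapping.keys p"] p by (auto simp: nonzero_def)
  have "e \<in> nonzero E" using e p by auto
  \<comment> \<open>Recasts maximality as a support condition suited to
    \<open>frag_induct_on\<close>: on basis elements from this set, the cone character at
    \<open>e\<close> and the coefficient at \<open>e\<close> agree.\<close>
  have "Poly_Mapping.keys p \<subseteq> {u. e \<odot> u = e \<longrightarrow> u = e}" using max by auto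
  then have "cone_character E e p = Poly_Mapping.lookup p e"
    using idem[OF nonzero_closed[OF \<open>e \<in> nonzero E\<close>]]
    by (induction p rule: frag_induct_on) (auto simp: lookup_minus lookup_frag_of)
  then show False using zero[OF \<open>e \<in> nonzero E\<close>] e by (simp add: in_keys_iff)
qed

text \<open>Cone characters are additive and multiplicative before any ring law is known, so each
  ring law reduces to the same law for integers.\<close>

lemma function_algebra_ZE: "function_algebra (ZE E)"
proof -
  interpret abelian_group "ZE E" by (rule abelian_group_ZE)
  have eqI: "p = q" if "p \<in> carrier (ZE E)" "q \<in> carrier (ZE E)"
    "\<And>x. x \<in> nonzero E \<Longrightarrow> cone_character E x p = cone_character E x q" for p q
    using cone_characters_separate[OF ZE_diff_closed[OF that(1,2)]] that(3) by simp
  note cm = character_mult[OF cone_character]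
  show ?thesis
  proof (intro function_algebra.intro z_algebra.intro abelian_group_ZE z_algebra_axioms.intro
      function_algebra_axioms.intro)
    fix p q r assume pqr: "p \<in> carrier (ZE E)" "q \<in> carrier (ZE E)" "r \<in> carrier (ZE E)"
    note pq = ZE_m_closed[OF pqr(1,2)] and qr = ZE_m_closed[OF pqr(2,3)] and pr = ZE_m_closed[OF pqr(1,3)]
      and rp = ZE_m_closed[OF pqr(3,1)] and rq = ZE_m_closed[OF pqr(3,2)]
      and p_q = a_closed[OF pqr(1,2)] and pq' = a_closed[OF pqr(1,2), unfolded ZE_simps(3)]
    show "p \<otimes>\<^bsub>ZE E\<^esub> q \<otimes>\<^bsub>ZE E\<^esub> r = p \<otimes>\<^bsub>ZE E\<^esub> (q \<otimes>\<^bsub>ZE E\<^esub> r)"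
      by (rule eqI[OF ZE_m_closed[OF pq pqr(3)] ZE_m_closed[OF pqr(1) qr]])
        (simp only: cm pqr pq qr mult.assoc)
    show "(p \<oplus>\<^bsub>ZE E\<^esub> q) \<otimes>\<^bsub>ZE E\<^esub> r = p \<otimes>\<^bsub>ZE E\<^esub> r \<oplus>\<^bsub>ZE E\<^esub> q \<otimes>\<^bsub>ZE E\<^esub> r"
      by (rule eqI[OF ZE_m_closed[OF p_q pqr(3)] a_closed[OF pr qr]])
        (simp only: cm pqr pr qr pq' ZE_simps(3)[of E] cone_character_simps distrib_right)
    show "r \<otimes>\<^bsub>ZE E\<^esub> (p \<oplus>\<^bsub>ZE E\<^esub> q) = r \<otimes>\<^bsub>ZE E\<^esub> p \<oplus>\<^bsub>ZE E\<^esub> r \<otimes>\<^bsub>ZE E\<^esub> q"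
      by (rule eqI[OF ZE_m_closed[OF pqr(3) p_q] a_closed[OF rp rq]])
        (simp only: cm pqr rp rq pq' ZE_simps(3)[of E] cone_character_simps distrib_left)
  qed (auto intro: ZE_m_closed eqI cone_character simp del: ZE_simps(1))
qed

end

sublocale zero_semilattice \<subseteq> Z: function_algebra "ZE E"
  by (rule function_algebra_ZE)

text \<open>The target is separated by characters, and the integer-valued criterion
  \<open>multiplicative_on_ZE\<close> applies to each composite of \<open>h\<close> with a
  character.\<close>

lemma (in zero_semilattice) alg_hom_ZE_I:
  assumes "function_algebra D" "\<And>p. p \<in> carrier (ZE E) \<Longrightarrow> h p \<in> carrier D"
    and add: "\<And>p q. \<lbrakk>p \<in> carrier (ZE E); q \<in> carrier (ZE E)\<rbrakk> \<Longrightarrow> h (p + q) = h p \<oplus>\<^bsub>D\<^esub> h q"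
    and mult: "\<And>e f. \<lbrakk>e \<in> nonzero E; f \<in> nonzero E\<rbrakk> \<Longrightarrow>
      h (basis E (e \<odot> f)) = h (frag_of e) \<otimes>\<^bsub>D\<^esub> h (frag_of f)"
  shows "h \<in> alg_hom (ZE E) D"
proof -
  interpret D: function_algebra D by fact
  have "h (p \<otimes>\<^bsub>ZE E\<^esub> q) = h p \<otimes>\<^bsub>D\<^esub> h q" if p: "p \<in> carrier (ZE E)" and q: "q \<in> carrier (ZE E)" for p q
  proof (rule D.separated)
    fix \<kappa> assume \<kappa>: "\<kappa> \<in> characters D"
    have "\<kappa> (h (p \<otimes>\<^bsub>ZE E\<^esub> q)) = \<kappa> (h p) * \<kappa> (h q)"
    proof (rule multiplicative_on_ZE[OF _ _ p q])
      fix e f assume ef: "e \<in> nonzero E" "f \<in> nonzero E"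
      then show "\<kappa> (h (basis E (e \<odot> f))) = \<kappa> (h (frag_of e)) * \<kappa> (h (frag_of f))"
        using assms(2)[of "frag_of e"] assms(2)[of "frag_of f"] character_mult[OF \<kappa>] by (simp add: mult)
    qed (simp only: add character_add[OF \<kappa>] assms(2))
    then show "\<kappa> (h (p \<otimes>\<^bsub>ZE E\<^esub> q)) = \<kappa> (h p \<otimes>\<^bsub>D\<^esub> h q)"
      by (simp only: character_mult[OF \<kappa>] assms(2) p q)
  qed (intro D.m_closed assms(2) ZE_m_closed p q)+
  then show ?thesis
    using assms(2) add by (auto simp: alg_hom_def)
qed

section \<open>The semilattice of gaps\<close>

context function_algebra
begin

lemma alg_hom_minus:
  assumes "abelian_group S" "h \<in> alg_hom S R" "x \<in> carrier S" "y \<in> carrier S"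
  shows "h (x \<ominus>\<^bsub>S\<^esub> y) = h x \<ominus> h y"
proof (rule separated)
  interpret S: abelian_group S by fact
  show "h (x \<ominus>\<^bsub>S\<^esub> y) \<in> carrier R" "h x \<ominus> h y \<in> carrier R"
    using assms by (auto intro!: alg_hom_closed[OF assms(2)] minus_closed)
  fix \<kappa> assume \<kappa>: "\<kappa> \<in> characters R"
  show "\<kappa> (h (x \<ominus>\<^bsub>S\<^esub> y)) = \<kappa> (h x \<ominus> h y)"
    using S.character_minus[OF character_comp_alg_hom[OF assms(2) \<kappa>] assms(3,4)]
      character_minus[OF \<kappa>] assms alg_hom_closed[OF assms(2)] by simp
qed

lemma minus_eq_zero_iff: "\<lbrakk>x \<in> carrier R; y \<in> carrier R\<rbrakk> \<Longrightarrow> x \<ominus> y = \<zero> \<longleftrightarrow> x = y"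
  using minus_equality[of x "\<ominus> y"] by (auto simp: a_minus_def r_neg)

lemma mult_zero_left: "x \<in> carrier R \<Longrightarrow> \<zero> \<otimes> x = \<zero>"
proof (rule separated)
  fix \<kappa> assume x: "x \<in> carrier R" and \<kappa>: "\<kappa> \<in> characters R"
  show "\<kappa> (\<zero> \<otimes> x) = \<kappa> \<zero>"
    using character_mult[OF \<kappa> zero_closed x] character_zero[OF \<kappa>] by simp
qed (auto intro: m_closed)

lemma mult_zero_right: "d \<in> carrier R \<Longrightarrow> d \<otimes> \<zero> = \<zero>"
  using m_comm[of d "\<zero>"] mult_zero_left[of d] by simp

lemma idem_mult:
  assumes "d \<in> carrier R" "d \<otimes> d = d" "f \<in> carrier R" "f \<otimes> f = f"
  shows "(d \<otimes> f) \<otimes> (d \<otimes> f) = d \<otimes> f"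
proof (rule separated)
  note df = m_closed[OF assms(1,3)]
  show "(d \<otimes> f) \<otimes> (d \<otimes> f) \<in> carrier R" "d \<otimes> f \<in> carrier R"
    by (rule m_closed[OF df df], rule df)
  fix \<kappa> assume \<kappa>: "\<kappa> \<in> characters R"
  show "\<kappa> ((d \<otimes> f) \<otimes> (d \<otimes> f)) = \<kappa> (d \<otimes> f)"
    using character_idem[OF \<kappa> assms(1,2)] character_idem[OF \<kappa> assms(3,4)]
    unfolding character_mult[OF \<kappa> df df] character_mult[OF \<kappa> assms(1,3)] by auto
qed

end

text \<open>
  The elements of \<open>S\<close> need be neither non-zero nor below \<open>e\<close>: this relaxation of \<open>x = e - \<Or>S\<close> is closed
  under products, and \<open>is_gap_normalise\<close> below recovers the form required in \<^const>\<open>E_phi\<close>.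
\<close>

definition is_gap :: "'a semilat \<Rightarrow> 'a \<Rightarrow> 'a set \<Rightarrow> ('a \<Rightarrow>\<^sub>0 int) \<Rightarrow> bool" where
  "is_gap E e S x \<longleftrightarrow> x \<in> carrier (ZE E) \<and> e \<in> carrier E \<and> finite S \<and> S \<subseteq> carrier E \<and>
     (\<forall>\<kappa>\<in>characters (ZE E). \<kappa> x = of_bool (\<kappa> (basis E e) = 1 \<and> (\<forall>s\<in>S. \<kappa> (basis E s) \<noteq> 1)))"

lemma is_gap_character:
  "\<lbrakk>is_gap E e S x; \<kappa> \<in> characters (ZE E)\<rbrakk> \<Longrightarrow>
    \<kappa> x = of_bool (\<kappa> (basis E e) = 1 \<and> (\<forall>s\<in>S. \<kappa> (basis E s) \<noteq> 1))"
  by (simp add: is_gap_def)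

context zero_semilattice
begin

lemma character_basis_mult:
  assumes "\<kappa> \<in> characters (ZE E)" "e \<in> carrier E" "f \<in> carrier E"
  shows "\<kappa> (basis E (e \<odot> f)) = \<kappa> (basis E e) * \<kappa> (basis E f)"
  using character_mult[OF assms(1)] basis_mult[OF assms(2,3)] basis_closed assms(2,3) by metis

lemma character_basis:
  assumes "\<kappa> \<in> characters (ZE E)" "e \<in> carrier E"
  shows "\<kappa> (basis E e) = 0 \<or> \<kappa> (basis E e) = 1"
  using character_basis_mult[OF assms(1,2,2)] assms by (auto simp: idem)

lemma character_basis_zero: "\<kappa> \<in> characters (ZE E) \<Longrightarrow> \<kappa> (basis E (szero E)) = 0"
  using Z.character_zero by (simp add: basis_def)

text \<open>The pair \<open>e\<close>, \<open>S\<close> prescribes the value of every character, and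
  characters separate points.\<close>

lemma is_gap_unique: "\<lbrakk>is_gap E e S x; is_gap E e S y\<rbrakk> \<Longrightarrow> x = y"
  by (rule Z.separated) (simp_all only: is_gap_character, simp_all only: is_gap_def)

lemma is_gap_zero: "is_gap E (szero E) {} 0"
  unfolding is_gap_def
  by (auto simp: zero_closed character_basis_zero Z.character_zero[unfolded ZE_simps])

text \<open>Intersection of two differences of sets: the tops are intersected and the removed
  families united.\<close>

lemma is_gap_mult:
  assumes "is_gap E e S x" "is_gap E f T y"
  shows "is_gap E (e \<odot> f) (S \<union> T) (x \<otimes>\<^bsub>ZE E\<^esub> y)"
  unfolding is_gap_def
proof (intro conjI ballI)
  show "x \<otimes>\<^bsub>ZE E\<^esub> y \<in> carrier (ZE E)" "e \<odot> f \<in> carrier E" "finite (S \<union> T)" "S \<union> T \<subseteq> carrier E"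
    using assms closed unfolding is_gap_def by (auto intro!: Z.m_closed simp del: ZE_simps(1))
  fix \<kappa> assume \<kappa>: "\<kappa> \<in> characters (ZE E)"
  have ef: "e \<in> carrier E" "f \<in> carrier E" and xy: "x \<in> carrier (ZE E)" "y \<in> carrier (ZE E)"
    using assms unfolding is_gap_def by auto
  show "\<kappa> (x \<otimes>\<^bsub>ZE E\<^esub> y) =
      of_bool (\<kappa> (basis E (e \<odot> f)) = 1 \<and> (\<forall>s\<in>S \<union> T. \<kappa> (basis E s) \<noteq> 1))"
    using character_basis[OF \<kappa> ef(1)] character_basis[OF \<kappa> ef(2)]
    unfolding character_mult[OF \<kappa> xy] character_basis_mult[OF \<kappa> ef]
      is_gap_character[OF assms(1) \<kappa>] is_gap_character[OF assms(2) \<kappa>] by auto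
qed

text \<open>The square is a gap for the top \<open>e \<odot> e = e\<close> and the family
  \<open>S \<union> S = S\<close>, hence equal to \<open>x\<close> by uniqueness.\<close>

lemma is_gap_idem:
  assumes "is_gap E e S x"
  shows "x \<otimes>\<^bsub>ZE E\<^esub> x = x"
  using is_gap_unique[OF is_gap_mult[OF assms assms]] assms idem[of e] by (simp add: is_gap_def)

text \<open>As each \<open>f j\<close> lies below \<open>e\<close>, its indicator is bounded by that
  of \<open>e\<close>; subtracting the join therefore leaves only the values 0 and 1.\<close>

lemma is_gap_big_vee:
  assumes "finite J" "e \<in> nonzero E" "\<And>j. j \<in> J \<Longrightarrow> f j \<in> nonzero E \<and> f j \<odot> e = f j"
  shows "is_gap E e (f ` J) (frag_of e \<ominus>\<^bsub>ZE E\<^esub> big_vee (ZE E) (\<lambda>j. frag_of (f j)) J)"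
  unfolding is_gap_def
proof (intro conjI ballI)
  have im: "(\<lambda>j. frag_of (f j)) ` J \<subseteq> carrier (ZE E)" using assms(3) by auto
  have e: "frag_of e \<in> carrier (ZE E)" "e \<in> carrier E" using assms(2) by (auto simp: nonzero_def)
  show "frag_of e \<ominus>\<^bsub>ZE E\<^esub> big_vee (ZE E) (\<lambda>j. frag_of (f j)) J \<in> carrier (ZE E)"
    by (rule Z.minus_closed[OF e(1) Z.big_vee_closed[OF assms(1) im]])
  show "e \<in> carrier E" "finite (f ` J)" "f ` J \<subseteq> carrier E"
    using assms by (auto simp: nonzero_def)
  fix \<kappa> assume \<kappa>: "\<kappa> \<in> characters (ZE E)"
  have f: "\<kappa> (frag_of (f j)) = \<kappa> (basis E (f j)) \<and>
      \<kappa> (basis E (f j)) = \<kappa> (basis E (f j)) * \<kappa> (basis E e) \<and> (\<kappa> (basis E (f j)) = 0 \<or> \<kappa> (basis E (f j)) = 1)"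
    if "j \<in> J" for j
    using character_basis_mult[OF \<kappa>, of "f j" e] character_basis[OF \<kappa>, of "f j"] e(2) assms(3)[OF that]
    by (simp add: basis_nonzero nonzero_closed)
  have P: "(\<Prod>j\<in>J. 1 - \<kappa> (frag_of (f j))) = of_bool (\<forall>j\<in>J. \<kappa> (basis E (f j)) \<noteq> 1)"
    (is "?P = _")
  proof (cases "\<exists>j\<in>J. \<kappa> (basis E (f j)) = 1")
    case True
    then have "?P = 0" using f assms(1) by (auto intro!: prod_zero)
    then show ?thesis using True by auto
  next
    case False
    then have "?P = 1" using f by (intro prod.neutral) auto
    then show ?thesis using False by auto
  qed
  have "\<kappa> (frag_of e \<ominus>\<^bsub>ZE E\<^esub> big_vee (ZE E) (\<lambda>j. frag_of (f j)) J) =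
      \<kappa> (basis E e) - (1 - of_bool (\<forall>j\<in>J. \<kappa> (basis E (f j)) \<noteq> 1))"
    unfolding Z.character_minus[OF \<kappa> e(1) Z.big_vee_closed[OF assms(1) im]]
      Z.character_big_vee[OF assms(1) im \<kappa>] P
    using assms(2) by (simp add: basis_nonzero)
  also have "\<dots> = of_bool (\<kappa> (basis E e) = 1 \<and> (\<forall>s\<in>f ` J. \<kappa> (basis E s) \<noteq> 1))"
    using character_basis[OF \<kappa> e(2)] f by auto
  finally show "\<kappa> (frag_of e \<ominus>\<^bsub>ZE E\<^esub> big_vee (ZE E) (\<lambda>j. frag_of (f j)) J) =
      of_bool (\<kappa> (basis E e) = 1 \<and> (\<forall>s\<in>f ` J. \<kappa> (basis E s) \<noteq> 1))" .
qed

text \<open>Replace each \<open>s\<close> by \<open>e \<odot> s\<close> and discard zeros; no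
  character value changes. Since \<open>x\<close> is non-zero, neither \<open>e = szero E\<close>
  nor \<open>e \<odot> s = e\<close> can occur, as either would make all values vanish.\<close>

lemma is_gap_normalise:
  assumes gap: "is_gap E e S x" and "x \<noteq> 0"
  obtains f and J :: "nat set" where "finite J" "e \<in> nonzero E"
    "\<And>j. j \<in> J \<Longrightarrow> f j \<in> nonzero E \<and> slat_less E (f j) e \<and> f j \<in> (\<lambda>s. e \<odot> s) ` S"
    "x = frag_of e \<ominus>\<^bsub>ZE E\<^esub> big_vee (ZE E) (\<lambda>j. frag_of (f j)) J"
proof -
  define T where "T = (\<lambda>s. e \<odot> s) ` S - {szero E}"
  have e: "e \<in> carrier E" and S: "finite S" "S \<subseteq> carrier E" and x: "x \<in> carrier (ZE E)"
    and \<kappa>x: "\<And>\<kappa>. \<kappa> \<in> characters (ZE E) \<Longrightarrow>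
      \<kappa> x = of_bool (\<kappa> (basis E e) = 1 \<and> (\<forall>s\<in>S. \<kappa> (basis E s) \<noteq> 1))"
    using gap by (auto simp: is_gap_def)
  have zeroI: "x = 0" if "\<And>\<kappa>. \<kappa> \<in> characters (ZE E) \<Longrightarrow> \<kappa> x = 0"
    using Z.separated[OF x Z.zero_closed] that Z.character_zero by (metis ZE_simps(2))
  have "e \<noteq> szero E"
  proof
    assume "e = szero E"
    then have "\<kappa> x = 0" if "\<kappa> \<in> characters (ZE E)" for \<kappa>
      using \<kappa>x[OF that] character_basis_zero[OF that] by simp
    then show False using zeroI \<open>x \<noteq> 0\<close> by blast
  qed
  with e have e': "e \<in> nonzero E" by (simp add: nonzero_def)
  have es: "\<kappa> (basis E (e \<odot> s)) = \<kappa> (basis E e) * \<kappa> (basis E s)"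
    if "\<kappa> \<in> characters (ZE E)" "s \<in> S" for \<kappa> s
    using character_basis_mult[OF that(1) e] that S by auto
  have "e \<noteq> e \<odot> s" if "s \<in> S" for s
  proof
    assume "e = e \<odot> s"
    then have "\<kappa> x = 0" if "\<kappa> \<in> characters (ZE E)" for \<kappa>
      using es[OF that \<open>s \<in> S\<close>] \<kappa>x[OF that] \<open>s \<in> S\<close> by auto
    then show False using zeroI \<open>x \<noteq> 0\<close> by blast
  qed
  then have T: "t \<in> nonzero E \<and> slat_less E t e \<and> t \<in> (\<lambda>s. e \<odot> s) ` S" if t: "t \<in> T" for t
  proof -
    obtain s where s: "s \<in> S" "t = e \<odot> s" "t \<noteq> szero E" using t by (auto simp: T_def)
    moreover have "s \<in> carrier E" using s S by auto
    moreover have "(e \<odot> s) \<odot> e = e \<odot> s"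
      using comm[OF closed[OF e \<open>s \<in> carrier E\<close>] e] assoc[OF e e \<open>s \<in> carrier E\<close>] idem[OF e] by simp
    ultimately show ?thesis
      using \<open>\<And>s. s \<in> S \<Longrightarrow> e \<noteq> e \<odot> s\<close>[OF s(1)] e closed[OF e \<open>s \<in> carrier E\<close>]
      by (auto simp: nonzero_def slat_less_def)
  qed
  have "finite T" using S by (simp add: T_def)
  \<comment> \<open>Enumerating \<open>T\<close> provides the index set of natural numbers that
    \<open>E_phi\<close> asks for.\<close>
  then obtain f where f: "bij_betw f {0..<card T} T"
    using ex_bij_betw_nat_finite by blast
  then have fT: "f ` {0..<card T} = T" by (simp add: bij_betw_def)
  then have fj: "f j \<in> nonzero E \<and> slat_less E (f j) e \<and> f j \<in> (\<lambda>s. e \<odot> s) ` S" if "j \<in> {0..<card T}" for j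
    using T that by blast
  have "is_gap E e T (frag_of e \<ominus>\<^bsub>ZE E\<^esub> big_vee (ZE E) (\<lambda>j. frag_of (f j)) {0..<card T})"
    using is_gap_big_vee[of "{0..<card T}" e f] fj e' fT by (auto simp: slat_less_def)
  moreover have "is_gap E e T x"
    unfolding is_gap_def
  proof (intro conjI ballI)
    show "T \<subseteq> carrier E" using T by (auto simp: nonzero_def)
    fix \<kappa> assume \<kappa>: "\<kappa> \<in> characters (ZE E)"
    have "(\<forall>s\<in>S. \<kappa> (basis E s) \<noteq> 1) \<longleftrightarrow> (\<forall>t\<in>T. \<kappa> (basis E t) \<noteq> 1)" if "\<kappa> (basis E e) = 1"
    proof -
      have *: "\<kappa> (basis E (e \<odot> s)) = \<kappa> (basis E s)" if "s \<in> S" for s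
        using es[OF \<kappa> that] \<open>\<kappa> (basis E e) = 1\<close> by simp
      have "\<kappa> (basis E s) \<noteq> 1" if "\<forall>t\<in>T. \<kappa> (basis E t) \<noteq> 1" "s \<in> S" for s
      proof (cases "e \<odot> s = szero E")
        case True
        then show ?thesis using *[OF that(2)] character_basis_zero[OF \<kappa>] by simp
      next
        case False
        then have "e \<odot> s \<in> T" using that(2) by (simp add: T_def)
        then show ?thesis using *[OF that(2)] that(1) by metis
      qed
      moreover have "\<kappa> (basis E t) \<noteq> 1" if "\<forall>s\<in>S. \<kappa> (basis E s) \<noteq> 1" "t \<in> T" for t
        using that * by (auto simp: T_def)
      ultimately show ?thesis by blast
    qed
    then show "\<kappa> x = of_bool (\<kappa> (basis E e) = 1 \<and> (\<forall>s\<in>T. \<kappa> (basis E s) \<noteq> 1))"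
      using \<kappa>x[OF \<kappa>] by auto
  qed (use x e \<open>finite T\<close> in auto)
  ultimately show thesis
    using that[of "{0..<card T}" f] e' fj is_gap_unique by blast
qed

text \<open>A join is an integer combination of products of the \<open>f j\<close>, so its support
  stays in any \<open>U\<close> closed under non-zero products.\<close>

lemma keys_big_vee:
  assumes "finite J" "f ` J \<subseteq> U" "U \<subseteq> nonzero E"
    and "\<And>e f. \<lbrakk>e \<in> U; f \<in> U\<rbrakk> \<Longrightarrow> e \<odot> f \<noteq> szero E \<Longrightarrow> e \<odot> f \<in> U"
  shows "Poly_Mapping.keys (big_vee (ZE E) (\<lambda>j. frag_of (f j)) J) \<subseteq> U"
  using assms(1,2)
proof (induction J rule: finite_induct)
  case empty
  then show ?case by (simp add: Z.big_vee_empty[simplified])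
next
  case (insert i J)
  let ?v = "big_vee (ZE E) (\<lambda>j. frag_of (f j)) J"
  have v: "Poly_Mapping.keys ?v \<subseteq> U" using insert by auto
  have "big_vee (ZE E) (\<lambda>j. frag_of (f j)) (insert i J) =
      (frag_of (f i) \<oplus>\<^bsub>ZE E\<^esub> ?v) \<ominus>\<^bsub>ZE E\<^esub> frag_of (f i) \<otimes>\<^bsub>ZE E\<^esub> ?v"
  proof (rule Z.big_vee_insert)
    have "f ` insert i J \<subseteq> nonzero E" using insert.prems assms(3) by blast
    then show "(\<lambda>j. frag_of (f j)) ` J \<subseteq> carrier (ZE E)" "frag_of (f i) \<in> carrier (ZE E)"
      by auto
  qed (use insert in auto)
  also have "\<dots> = (frag_of (f i) + ?v) - frag_of (f i) \<otimes>\<^bsub>ZE E\<^esub> ?v"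
    using insert.prems v assms(3) Z.m_closed[of "frag_of (f i)" ?v] by (subst ZE_minus) auto
  finally have *: "big_vee (ZE E) (\<lambda>j. frag_of (f j)) (insert i J) =
      (frag_of (f i) + ?v) - frag_of (f i) \<otimes>\<^bsub>ZE E\<^esub> ?v" .
  have "Poly_Mapping.keys (frag_of (f i)) \<subseteq> U" using insert.prems by auto
  then have "Poly_Mapping.keys (frag_of (f i) \<otimes>\<^bsub>ZE E\<^esub> ?v) \<subseteq> U"
    by (rule keys_ZE_mult[OF _ v assms(4)])
  moreover have "Poly_Mapping.keys (frag_of (f i) + ?v) \<subseteq> U"
    using v \<open>Poly_Mapping.keys (frag_of (f i)) \<subseteq> U\<close> keys_add[of "frag_of (f i)" ?v] by blast
  ultimately show ?case
    unfolding * using keys_diff[of "frag_of (f i) + ?v" "frag_of (f i) \<otimes>\<^bsub>ZE E\<^esub> ?v"] by blast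
qed

end

text \<open>A single stage of the recursion. The target \<open>D\<close> will be the given algebra
  or the semilattice algebra of the level below, so one argument serves every degree.\<close>

locale resolution_step = zero_semilattice E + D: function_algebra D
  for E :: "'a semilat" (structure) and D :: "('d, 'm) ring_scheme" +
  fixes \<phi>
  assumes hom: "\<phi> \<in> alg_hom (ZE E) D"
begin

lemma \<phi>_zero: "\<phi> 0 = \<zero>\<^bsub>D\<^esub>"
  using D.alg_hom_zero[OF abelian_group_ZE hom] by simp

text \<open>As \<phi> preserves differences and joins, the equation required in \<open>E_phi\<close>
  says that \<phi> kills the gap; zero is the gap with top \<open>szero E\<close>. With
  \<open>is_gap_normalise\<close> for the converse, \<open>E_phi\<close> becomes the set of all gaps
  in the kernel, from which closure under products is immediate.\<close>

lemma E_phi_mem: "x \<in> carrier (E_phi D E \<phi>) \<longleftrightarrow> (\<exists>e S. is_gap E e S x) \<and> \<phi> x = \<zero>\<^bsub>D\<^esub>"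
proof -
  have iff: "\<phi> (frag_of e \<ominus>\<^bsub>ZE E\<^esub> big_vee (ZE E) (\<lambda>j. frag_of (f j)) J) = \<zero>\<^bsub>D\<^esub> \<longleftrightarrow>
      \<phi> (frag_of e) = big_vee D (\<lambda>j. \<phi> (frag_of (f j))) J"
    if "finite J" "e \<in> nonzero E" "f ` J \<subseteq> nonzero E" for e f and J :: "nat set"
  proof -
    have e: "frag_of e \<in> carrier (ZE E)" and im: "(\<lambda>j. frag_of (f j)) ` J \<subseteq> carrier (ZE E)"
      using that by auto
    have "\<phi> (frag_of e \<ominus>\<^bsub>ZE E\<^esub> big_vee (ZE E) (\<lambda>j. frag_of (f j)) J) =
        \<phi> (frag_of e) \<ominus>\<^bsub>D\<^esub> big_vee D (\<lambda>j. \<phi> (frag_of (f j))) J"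
      unfolding D.alg_hom_minus[OF abelian_group_ZE hom e Z.big_vee_closed[OF that(1) im]]
        D.alg_hom_big_vee[OF function_algebra_ZE hom that(1) im] ..
    moreover have "\<phi> (frag_of e) \<in> carrier D" "big_vee D (\<lambda>j. \<phi> (frag_of (f j))) J \<in> carrier D"
      using alg_hom_closed[OF hom e] D.alg_hom_big_vee[OF function_algebra_ZE hom that(1) im]
        alg_hom_closed[OF hom Z.big_vee_closed[OF that(1) im]] by auto
    ultimately show ?thesis by (simp add: D.minus_eq_zero_iff)
  qed
  show ?thesis
  proof
    assume "x \<in> carrier (E_phi D E \<phi>)"
    then consider "x = 0" | e f and J :: "nat set" where "finite J" "e \<in> nonzero E"
      "\<And>j. j \<in> J \<Longrightarrow> f j \<in> nonzero E \<and> slat_less E (f j) e"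
      "\<phi> (frag_of e) = big_vee D (\<lambda>j. \<phi> (frag_of (f j))) J"
      "x = frag_of e \<ominus>\<^bsub>ZE E\<^esub> big_vee (ZE E) (\<lambda>j. frag_of (f j)) J"
      by (auto simp: E_phi_def)
    then show "(\<exists>e S. is_gap E e S x) \<and> \<phi> x = \<zero>\<^bsub>D\<^esub>"
    proof cases
      case 1
      then show ?thesis using is_gap_zero \<phi>_zero by blast
    next
      case 2
      then show ?thesis
        using is_gap_big_vee[of J e f] iff[of J e f] by (auto simp: slat_less_def)
    qed
  next
    assume "(\<exists>e S. is_gap E e S x) \<and> \<phi> x = \<zero>\<^bsub>D\<^esub>"
    then obtain e S where gap: "is_gap E e S x" and \<phi>: "\<phi> x = \<zero>\<^bsub>D\<^esub>" by blast
    show "x \<in> carrier (E_phi D E \<phi>)"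
    proof (cases "x = 0")
      case True
      then show ?thesis by (simp add: E_phi_def)
    next
      case False
      obtain f and J :: "nat set" where J: "finite J" "e \<in> nonzero E"
        "\<And>j. j \<in> J \<Longrightarrow> f j \<in> nonzero E \<and> slat_less E (f j) e \<and> f j \<in> (\<lambda>s. e \<odot> s) ` S"
        "x = frag_of e \<ominus>\<^bsub>ZE E\<^esub> big_vee (ZE E) (\<lambda>j. frag_of (f j)) J"
        by (rule is_gap_normalise[OF gap False]) blast
      moreover have "\<phi> (frag_of e) = big_vee D (\<lambda>j. \<phi> (frag_of (f j))) J"
        using iff[of J e f] J \<phi> by auto
      ultimately show ?thesis
        unfolding E_phi_def partial_object.simps
        by (intro UnI1 CollectI exI[of _ e] exI[of _ f] exI[of _ J] conjI ballI) simp_all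
    qed
  qed
qed

lemma E_phi_simps: "sprod (E_phi D E \<phi>) = (\<otimes>\<^bsub>ZE E\<^esub>)" "szero (E_phi D E \<phi>) = 0"
  by (simp_all add: E_phi_def)

lemma E_phi_closed: "x \<in> carrier (E_phi D E \<phi>) \<Longrightarrow> x \<in> carrier (ZE E)"
  by (auto simp: E_phi_mem is_gap_def)

lemma zero_semilattice_E_phi: "zero_semilattice (E_phi D E \<phi>)"
proof
  fix x y assume x: "x \<in> carrier (E_phi D E \<phi>)" and y: "y \<in> carrier (E_phi D E \<phi>)"
  then obtain e S f T where gap: "is_gap E e S x" "is_gap E f T y" and \<phi>: "\<phi> x = \<zero>\<^bsub>D\<^esub>"
    using E_phi_mem by metis
  note Cx = E_phi_closed[OF x] and Cy = E_phi_closed[OF y]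
  show "x \<odot>\<^bsub>E_phi D E \<phi>\<^esub> y \<in> carrier (E_phi D E \<phi>)"
    using is_gap_mult[OF gap] alg_hom_mult[OF hom Cx Cy] \<phi> D.mult_zero_left[OF alg_hom_closed[OF hom Cy]]
    unfolding E_phi_mem E_phi_simps by auto
  show "x \<odot>\<^bsub>E_phi D E \<phi>\<^esub> y = y \<odot>\<^bsub>E_phi D E \<phi>\<^esub> x"
    using Z.m_comm[OF Cx Cy] by (simp add: E_phi_simps)
  show "x \<odot>\<^bsub>E_phi D E \<phi>\<^esub> x = x"
    using is_gap_idem[OF gap(1)] by (simp add: E_phi_simps)
  show "szero (E_phi D E \<phi>) \<odot>\<^bsub>E_phi D E \<phi>\<^esub> x = szero (E_phi D E \<phi>)"
    by (simp add: E_phi_simps)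
  fix z assume z: "z \<in> carrier (E_phi D E \<phi>)"
  show "x \<odot>\<^bsub>E_phi D E \<phi>\<^esub> y \<odot>\<^bsub>E_phi D E \<phi>\<^esub> z = x \<odot>\<^bsub>E_phi D E \<phi>\<^esub> (y \<odot>\<^bsub>E_phi D E \<phi>\<^esub> z)"
    using Z.m_assoc[OF Cx Cy E_phi_closed[OF z]] by (simp add: E_phi_simps)
next
  show "szero (E_phi D E \<phi>) \<in> carrier (E_phi D E \<phi>)"
    using is_gap_zero \<phi>_zero unfolding E_phi_mem E_phi_simps by blast
qed

end

section \<open>The kernel is spanned by gaps\<close>

lemma frag_extend_closed:
  assumes "Poly_Mapping.keys p \<subseteq> S" "\<And>e. e \<in> S \<Longrightarrow> \<psi> e \<in> carrier (ZE F)"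
  shows "frag_extend \<psi> p \<in> carrier (ZE F)"
proof -
  have "(\<Union>e\<in>Poly_Mapping.keys p. Poly_Mapping.keys (\<psi> e)) \<subseteq> nonzero F"
    using assms by auto
  then show ?thesis using keys_frag_extend[of \<psi> p] by auto
qed

lemma frag_extend_frag_extend: "frag_extend f (frag_extend g p) = frag_extend (\<lambda>e. frag_extend f (g e)) p"
  using subset_UNIV[of "Poly_Mapping.keys p"]
  by (induction p rule: frag_induct_on) (auto simp: frag_extend_diff)

text \<open>Closure of the carrier guarantees that sums and products are again points where
  \<open>h\<close> and \<open>k\<close> agree.\<close>

lemma alg_hom_cong:
  assumes "h \<in> alg_hom R S" "z_algebra R" "\<And>x. x \<in> carrier R \<Longrightarrow> h x = k x"
  shows "k \<in> alg_hom R S"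
proof -
  interpret z_algebra R by fact
  have "\<And>x y. \<lbrakk>x \<in> carrier R; y \<in> carrier R\<rbrakk> \<Longrightarrow> x \<oplus>\<^bsub>R\<^esub> y \<in> carrier R \<and> x \<otimes>\<^bsub>R\<^esub> y \<in> carrier R"
    using m_closed by auto
  then show ?thesis using assms(1,3) by (simp add: alg_hom_def Pi_iff)
qed

lemma alg_hom_comp: "\<lbrakk>h \<in> alg_hom R S; k \<in> alg_hom S T\<rbrakk> \<Longrightarrow> (\<lambda>x. k (h x)) \<in> alg_hom R T"
  by (simp add: alg_hom_def Pi_iff)

context zero_semilattice
begin

text \<open>Existence in the universal property of the semilattice algebra, for targets of the same
  kind. Multiplicativity at a vanishing product is where \<psi> has to send zero to 0.\<close>

lemma frag_extend_alg_hom: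
  assumes F: "zero_semilattice F" and closed: "\<And>e. e \<in> carrier E \<Longrightarrow> \<psi> e \<in> carrier (ZE F)"
    and mult: "\<And>e f. \<lbrakk>e \<in> carrier E; f \<in> carrier E\<rbrakk> \<Longrightarrow> \<psi> (e \<odot> f) = \<psi> e \<otimes>\<^bsub>ZE F\<^esub> \<psi> f"
    and "\<psi> (szero E) = 0"
  shows "frag_extend \<psi> \<in> alg_hom (ZE E) (ZE F)"
proof (rule alg_hom_ZE_I)
  show "function_algebra (ZE F)" by (rule zero_semilattice.function_algebra_ZE[OF F])
  show "frag_extend \<psi> p \<in> carrier (ZE F)" if "p \<in> carrier (ZE E)" for p
    by (rule frag_extend_closed[of p "nonzero E"]) (use that closed nonzero_closed in auto)
  show "frag_extend \<psi> (p + q) = frag_extend \<psi> p \<oplus>\<^bsub>ZE F\<^esub> frag_extend \<psi> q" for p q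
    by (simp add: frag_extend_add)
  show "frag_extend \<psi> (basis E (e \<odot> f)) = frag_extend \<psi> (frag_of e) \<otimes>\<^bsub>ZE F\<^esub> frag_extend \<psi> (frag_of f)"
    if "e \<in> nonzero E" "f \<in> nonzero E" for e f
  proof -
    have "frag_extend \<psi> (basis E (e \<odot> f)) = \<psi> (e \<odot> f)"
      using assms(4) by (simp add: basis_def)
    then show ?thesis using mult[of e f] that by (simp add: nonzero_closed)
  qed
qed

text \<open>Adjoining an idempotent \<open>x\<close> to a finite subsemilattice \<open>U\<close>
  creates only \<open>x\<close> and the products \<open>x \<odot> u\<close>, so finiteness persists
  in the induction.\<close>

lemma finite_subsemilattice:
  assumes "finite K" "K \<subseteq> carrier E"
  obtains U where "finite U" "K \<subseteq> U" "U \<subseteq> carrier E" "\<And>a b. \<lbrakk>a \<in> U; b \<in> U\<rbrakk> \<Longrightarrow> a \<odot> b \<in> U"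
proof -
  have "\<exists>U. finite U \<and> K \<subseteq> U \<and> U \<subseteq> carrier E \<and> (\<forall>a\<in>U. \<forall>b\<in>U. a \<odot> b \<in> U)"
    using assms
  proof (induction K rule: finite_induct)
    case empty
    show ?case by (rule exI[of _ "{}"]) simp
  next
    case (insert x K)
    then obtain U where U: "finite U" "K \<subseteq> U" "U \<subseteq> carrier E" "\<forall>a\<in>U. \<forall>b\<in>U. a \<odot> b \<in> U"
      by auto
    have x: "x \<in> carrier E" using insert by simp
    let ?V = "insert x (U \<union> (\<lambda>u. x \<odot> u) ` U)"
    have xx: "x \<odot> (x \<odot> u) = x \<odot> u" if "u \<in> U" for u
      using assoc[of x x u] that U(3) x by (auto simp: idem)
    have ux: "u \<odot> x = x \<odot> u" if "u \<in> U" for u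
      using comm that U(3) x by auto
    have uxv: "u \<odot> (x \<odot> v) = x \<odot> (u \<odot> v)" if "u \<in> U" "v \<in> U" for u v
      using assoc[of u x v] assoc[of x u v] ux[OF that(1)] subsetD[OF U(3)] that x by metis
    have xuv: "(x \<odot> u) \<odot> v = x \<odot> (u \<odot> v)" if "u \<in> U" "v \<in> U" for u v
      using assoc[of x u v] that U(3) x by auto
    have xuxv: "(x \<odot> u) \<odot> (x \<odot> v) = x \<odot> (u \<odot> v)" if "u \<in> U" "v \<in> U" for u v
      using assoc[of x u "x \<odot> v"] uxv[OF that] xx[of "u \<odot> v"] that U(3,4) x closed[of x v] by auto
    have xux: "(x \<odot> u) \<odot> x = x \<odot> u" if "u \<in> U" for u
      using assoc[of x u x] ux[OF that] xx[OF that] that U(3) x by auto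
    have "a \<odot> b \<in> ?V" if "a \<in> ?V" "b \<in> ?V" for a b
      using that U(4) xx ux uxv xuv xuxv xux idem[OF x] by auto
    then show ?case
      using U x closed by (intro exI[of _ ?V]) auto
  qed
  then show thesis using that by metis
qed

lemma character_frag_cmul:
  assumes "\<kappa> \<in> characters (ZE E)" "p \<in> carrier (ZE E)"
  shows "\<kappa> (frag_cmul c p) = c * \<kappa> p"
proof (induction c rule: int_induct[of _ 0])
  case base
  then show ?case using Z.character_zero[OF assms(1)] by simp
next
  case (step1 c)
  have "frag_cmul c p \<in> carrier (ZE E)" using assms(2) keys_cmul[of c p] by auto
  then show ?case
    using step1 character_add[OF assms(1) _ assms(2), of "frag_cmul c p"]
    by (simp add: frag_cmul_distrib algebra_simps)
next
  case (step2 c)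
  have "frag_cmul (c - 1) p \<in> carrier (ZE E)" using assms(2) keys_cmul[of "c - 1" p] by auto
  then show ?case
    using step2 character_add[OF assms(1) _ assms(2), of "frag_cmul (c - 1) p"]
      frag_cmul_distrib[of "c - 1" 1 p]
    by (simp add: algebra_simps)
qed

text \<open>Isolates the top of a gap in its support. In both uses \<open>v\<close> is a join of
  elements strictly below \<open>e\<close>, so its support misses \<open>e\<close>.\<close>

lemma lookup_gap:
  assumes "e \<in> nonzero E" "Poly_Mapping.keys v \<subseteq> nonzero E" "e \<notin> Poly_Mapping.keys v"
  shows "Poly_Mapping.lookup (frag_of e \<ominus>\<^bsub>ZE E\<^esub> v) e = 1"
    and "Poly_Mapping.keys (frag_of e \<ominus>\<^bsub>ZE E\<^esub> v) \<subseteq> insert e (Poly_Mapping.keys v)"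
proof -
  have eq: "frag_of e \<ominus>\<^bsub>ZE E\<^esub> v = frag_of e - v" using assms(2) by (intro ZE_minus) auto
  show "Poly_Mapping.lookup (frag_of e \<ominus>\<^bsub>ZE E\<^esub> v) e = 1"
    using assms(3) by (simp add: eq lookup_minus in_keys_iff)
  show "Poly_Mapping.keys (frag_of e \<ominus>\<^bsub>ZE E\<^esub> v) \<subseteq> insert e (Poly_Mapping.keys v)"
    unfolding eq using keys_diff[of "frag_of e" v] by auto
qed

end

context resolution_step
begin

text \<open>The set \<open>I\<close> abstracts a subgroup containing \<open>E_phi\<close>, keeping
  the argument apart from any presentation of that subgroup; it is instantiated with the image of
  \<open>res_delta\<close>. The induction removes one maximal element of \<open>U\<close> at a
  time.\<close>

lemma kernel_in_span:
  assumes "finite U" "U \<subseteq> carrier E" "\<And>a b. \<lbrakk>a \<in> U; b \<in> U\<rbrakk> \<Longrightarrow> a \<odot> b \<in> U"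
    and "Poly_Mapping.keys p \<subseteq> U \<inter> nonzero E" "\<phi> p = \<zero>\<^bsub>D\<^esub>"
    and I: "0 \<in> I" "\<And>x y. \<lbrakk>x \<in> I; y \<in> I\<rbrakk> \<Longrightarrow> x + y \<in> I" "\<And>c x. x \<in> I \<Longrightarrow> frag_cmul c x \<in> I"
      "carrier (E_phi D E \<phi>) \<subseteq> I"
  shows "p \<in> I"
  using assms(1-5)
proof (induction U arbitrary: p rule: finite_psubset_induct)
  case (psubset U)
  let ?K = "U \<inter> nonzero E"
  show ?case
  proof (cases "?K = {}")
    case True
    then have "p = 0" using psubset.prems(3) by (simp add: keys_eq_empty)
    then show ?thesis using I(1) by simp
  next
    case False
    obtain e where e: "e \<in> ?K" and max: "\<And>u. \<lbrakk>u \<in> ?K; e \<odot> u = e\<rbrakk> \<Longrightarrow> u = e"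
      by (rule exists_maximal[of ?K]) (use False psubset in auto)
    define U' where "U' = U - {e}"
    have C: "e \<in> carrier E" "e \<noteq> szero E" "\<And>u. u \<in> U \<Longrightarrow> u \<in> carrier E"
      using e psubset.prems(1) by (auto simp: nonzero_def)
    \<comment> \<open>If \<open>u \<odot> v = e\<close> then \<open>u\<close> lies above
      \<open>e\<close>, so \<open>u = e\<close> by maximality, which \<open>U'\<close> excludes.
      Hence \<open>U'\<close> remains closed under products.\<close>
    have max': "u \<odot> v \<noteq> e" if "u \<in> U'" "v \<in> U" for u v
    proof
      assume uv: "u \<odot> v = e"
      have u: "u \<in> carrier E" and v: "v \<in> carrier E" using that C by (auto simp: U'_def)
      have "e \<odot> u = e"
        using uv comm[OF u v] assoc[OF v u u] idem[OF u] by auto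
      moreover have "u \<noteq> szero E" using uv zero[OF v] C(2) by auto
      ultimately show False
        using max[of u] that(1) u by (auto simp: U'_def nonzero_def)
    qed
    have U'_closed: "a \<odot> b \<in> U'" if "a \<in> U'" "b \<in> U'" for a b
      using that max'[of a b] psubset.prems(2)[of a b] by (auto simp: U'_def)
    have U': "U' \<subset> U" "U' \<subseteq> carrier E" using e C(3) by (auto simp: U'_def)
    define n where "n = Poly_Mapping.lookup p e"
    \<comment> \<open>All non-zero elements of \<open>U\<close> strictly below \<open>e\<close>, so
      that \<open>q\<close> is the smallest gap with top \<open>e\<close> that can be cut out using
      elements of \<open>U\<close>.\<close>
    define S where "S = {u \<in> U' \<inter> nonzero E. u \<odot> e = u}"
    define v where "v = big_vee (ZE E) (\<lambda>u. frag_of u) S"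
    define q where "q = frag_of e \<ominus>\<^bsub>ZE E\<^esub> v"
    have "finite S" using psubset.hyps by (simp add: S_def U'_def)
    have gap: "is_gap E e S q"
    proof -
      have "u \<in> nonzero E \<and> u \<odot> e = u" if "u \<in> S" for u using that by (simp add: S_def)
      then show ?thesis
        using is_gap_big_vee[of S e "\<lambda>u. u"] \<open>finite S\<close> e unfolding q_def v_def by auto
    qed
    have v: "Poly_Mapping.keys v \<subseteq> U' \<inter> nonzero E"
      unfolding v_def
    proof (rule keys_big_vee[OF \<open>finite S\<close>])
      show "(\<lambda>u. u) ` S \<subseteq> U' \<inter> nonzero E" by (auto simp: S_def)
      show "a \<odot> b \<in> U' \<inter> nonzero E"
        if "a \<in> U' \<inter> nonzero E" "b \<in> U' \<inter> nonzero E" "a \<odot> b \<noteq> szero E" for a b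
        using that U'_closed[of a b] closed[of a b] by (simp add: nonzero_def)
    qed simp
    then have q: "Poly_Mapping.lookup q e = 1" "Poly_Mapping.keys q \<subseteq> ?K"
      using lookup_gap[of e v] e U'(1) unfolding q_def U'_def by auto
    have Cp: "p \<in> carrier (ZE E)" and Cq: "q \<in> carrier (ZE E)"
      using psubset.prems(3) q by auto
    \<comment> \<open>The identity \<open>p q = n q\<close>, read on characters. Where
      \<open>q\<close> has value 1, \<open>e\<close> has value 1 and every element of
      \<open>S\<close> has value 0. For \<open>u \<noteq> e\<close> in the support,
      \<open>u \<odot> e\<close> is zero or in \<open>S\<close>, so \<open>u\<close> has value 0 and
      only the coefficient at \<open>e\<close> remains.\<close>
    have \<kappa>_p: "\<kappa> p = n" if \<kappa>: "\<kappa> \<in> characters (ZE E)" and one: "\<kappa> q = 1" for \<kappa>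
    proof -
      have \<kappa>e: "\<kappa> (basis E e) = 1" and \<kappa>S: "\<And>u. u \<in> S \<Longrightarrow> \<kappa> (basis E u) \<noteq> 1"
        using is_gap_character[OF gap \<kappa>] one by (auto split: if_splits)
      from psubset.prems(3) have "\<kappa> p = Poly_Mapping.lookup p e"
      proof (induction p rule: frag_induct_on)
        case zero
        then show ?case using Z.character_zero[OF \<kappa>] by simp
      next
        case (one u)
        have u: "u \<in> U" "u \<in> carrier E" "u \<noteq> szero E" using one by (auto simp: nonzero_def)
        have "\<kappa> (basis E u) = 0" if "u \<noteq> e"
        proof (cases "u \<odot> e = szero E")
          case True
          then show ?thesis
            using character_basis_mult[OF \<kappa> u(2) C(1)] \<kappa>e character_basis_zero[OF \<kappa>] by simp
        next
          case False
          have "(u \<odot> e) \<odot> e = u \<odot> e" using assoc[OF u(2) C(1,1)] idem[OF C(1)] by simp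
          moreover have "u \<odot> e \<noteq> e" using max'[of u e] that u e by (simp add: U'_def)
          ultimately have "u \<odot> e \<in> S"
            using False closed[OF u(2) C(1)] psubset.prems(2)[of u e] u e
            by (simp add: S_def U'_def nonzero_def)
          then show ?thesis
            using \<kappa>S[of "u \<odot> e"] character_basis_mult[OF \<kappa> u(2) C(1)] \<kappa>e character_basis[OF \<kappa> u(2)]
            by auto
        qed
        then show ?case using \<kappa>e one by (auto simp: basis_nonzero)
      next
        case (diff p q)
        then have "p \<in> carrier (ZE E)" "q \<in> carrier (ZE E)" by auto
        then show ?case
          using Z.character_minus[OF \<kappa>, of p q] ZE_minus[of q E p] diff by (simp add: lookup_minus)
      qed
      then show ?thesis by (simp add: n_def)
    qed
    show ?thesis
    proof (cases "n = 0")
      case True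
      then have "Poly_Mapping.keys p \<subseteq> U' \<inter> nonzero E"
        using psubset.prems(3) by (auto simp: U'_def n_def in_keys_iff)
      then show ?thesis
        using psubset.IH[OF U'(1,2) U'_closed] psubset.prems(4) by blast
    next
      case False
      have "\<phi> q = \<zero>\<^bsub>D\<^esub>"
      proof (rule D.separated)
        fix \<kappa> assume \<kappa>: "\<kappa> \<in> characters D"
        note \<kappa>' = character_comp_alg_hom[OF hom \<kappa>]
        \<comment> \<open>The value 1 would give \<open>n = 0\<close> by \<open>\<kappa>_p\<close>,
          since \<phi> kills \<open>p\<close>; a gap has no other value than 0 and 1.\<close>
        have "\<kappa> (\<phi> q) \<noteq> 1"
          using \<kappa>_p[OF \<kappa>'] False psubset.prems(4) D.character_zero[OF \<kappa>] by auto
        then show "\<kappa> (\<phi> q) = \<kappa> \<zero>\<^bsub>D\<^esub>"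
          using is_gap_character[OF gap \<kappa>'] D.character_zero[OF \<kappa>] by (auto split: if_splits)
      qed (use alg_hom_closed[OF hom Cq] in auto)
      then have "q \<in> I" using I(4) gap E_phi_mem by blast
      have Cnq: "frag_cmul n q \<in> carrier (ZE E)" using Cq keys_cmul[of n q] by auto
      have "\<phi> (p - frag_cmul n q) = \<zero>\<^bsub>D\<^esub>"
      proof (rule D.separated)
        fix \<kappa> assume \<kappa>: "\<kappa> \<in> characters D"
        note \<kappa>' = character_comp_alg_hom[OF hom \<kappa>]
        show "\<kappa> (\<phi> (p - frag_cmul n q)) = \<kappa> \<zero>\<^bsub>D\<^esub>"
          using Z.character_minus[OF \<kappa>' Cp Cnq] ZE_minus[OF Cnq, of p]
            character_frag_cmul[OF \<kappa>' Cq, of n] \<open>\<phi> q = \<zero>\<^bsub>D\<^esub>\<close> psubset.prems(4) D.character_zero[OF \<kappa>]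
          by simp
      qed (use alg_hom_closed[OF hom ZE_diff_closed[OF Cp Cnq]] in auto)
      \<comment> \<open>Both \<open>p\<close> and \<open>n q\<close> have coefficient
        \<open>n\<close> at \<open>e\<close>, so their difference is supported in \<open>U'\<close>
        and the induction hypothesis applies.\<close>
      moreover have "Poly_Mapping.lookup (p - frag_cmul n q) e = 0"
        using q by (simp add: lookup_minus n_def)
      then have "Poly_Mapping.keys (p - frag_cmul n q) \<subseteq> U' \<inter> nonzero E"
        using keys_diff[of p "frag_cmul n q"] keys_cmul[of n q] q(2) psubset.prems(3)
        unfolding U'_def by (auto simp: in_keys_iff)
      ultimately have "p - frag_cmul n q \<in> I"
        using psubset.IH[OF U'(1,2) U'_closed] by blast
      then have "(p - frag_cmul n q) + frag_cmul n q \<in> I"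
        using I(2,3) \<open>q \<in> I\<close> by blast
      then show ?thesis by simp
    qed
  qed
qed

end

section \<open>Transport of semilattices along injective renamings\<close>

lemma rename_simps:
  "carrier (rename r E) = r ` carrier E" "szero (rename r E) = r (szero E)"
  by (simp_all add: rename_def)

lemma rename_sprod:
  assumes "inj_on r (carrier E)" "x \<in> carrier E" "y \<in> carrier E"
  shows "r x \<odot>\<^bsub>rename r E\<^esub> r y = r (x \<odot>\<^bsub>E\<^esub> y)"
  using assms by (simp add: rename_def)

lemma zero_semilattice_rename:
  assumes "zero_semilattice E" "inj_on r (carrier E)"
  shows "zero_semilattice (rename r E)"
proof -
  interpret zero_semilattice E by fact
  show ?thesis
    by unfold_locales
      (auto simp: rename_simps rename_sprod[OF assms(2)] closed assoc idem zero zero_closed intro: arg_cong[OF comm])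
qed

lemma nonzero_rename:
  assumes "zero_semilattice E" "inj_on r (carrier E)"
  shows "nonzero (rename r E) = r ` nonzero E"
  using assms(2) zero_semilattice.zero_closed[OF assms(1)]
  by (auto simp: nonzero_def rename_simps inj_on_def)

section \<open>Group actions\<close>

text \<open>Bijectivity comes from the action of the inverse; extensionality turns the pointwise
  composition law into an equality in \<open>BijGroup\<close>.\<close>

lemma group_actionI:
  assumes "group G" and ext: "\<And>g. g \<in> carrier G \<Longrightarrow> \<beta> g \<in> extensional S"
    and closed: "\<And>g x. \<lbrakk>g \<in> carrier G; x \<in> S\<rbrakk> \<Longrightarrow> \<beta> g x \<in> S"
    and one: "\<And>x. x \<in> S \<Longrightarrow> \<beta> \<one>\<^bsub>G\<^esub> x = x"
    and mult: "\<And>g h x. \<lbrakk>g \<in> carrier G; h \<in> carrier G; x \<in> S\<rbrakk> \<Longrightarrow> \<beta> (g \<otimes>\<^bsub>G\<^esub> h) x = \<beta> g (\<beta> h x)"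
  shows "group_action G S \<beta>"
proof -
  interpret G: group G by fact
  have Bij: "\<beta> g \<in> Bij S" if g: "g \<in> carrier G" for g
  proof -
    have "\<beta> (inv\<^bsub>G\<^esub> g) (\<beta> g x) = x" "\<beta> g (\<beta> (inv\<^bsub>G\<^esub> g) x) = x" if "x \<in> S" for x
      using mult[of "inv\<^bsub>G\<^esub> g" g x] mult[of g "inv\<^bsub>G\<^esub> g" x] g that one by auto
    then have "bij_betw (\<beta> g) S S"
      using g closed by (intro bij_betw_byWitness[where f' = "\<beta> (inv\<^bsub>G\<^esub> g)"]) auto
    then show ?thesis using ext[OF g] by (simp add: Bij_def)
  qed
  have "\<beta> (g \<otimes>\<^bsub>G\<^esub> h) = compose S (\<beta> g) (\<beta> h)" if "g \<in> carrier G" "h \<in> carrier G" for g h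
    using that mult ext[of "g \<otimes>\<^bsub>G\<^esub> h"]
    by (intro extensionalityI[of _ S]) (auto simp: compose_def)
  then have "\<beta> \<in> hom G (BijGroup S)"
    using Bij by (auto simp: hom_def BijGroup_def)
  then show ?thesis
    unfolding group_action_def group_hom_def group_hom_axioms_def
    using G.group_axioms group_BijGroup by blast
qed

lemma ZE_action_apply:
  "p \<in> carrier (ZE E) \<Longrightarrow> ZE_action E \<beta> g p = frag_extend (\<lambda>e. frag_of (\<beta> g e)) p"
  by (simp add: ZE_action_def)

locale group_semilattice = zero_semilattice E + group \<Gamma>
  for E :: "'a semilat" (structure) and \<Gamma> :: "('g, 'l) monoid_scheme" +
  fixes \<beta> :: "'g \<Rightarrow> 'a \<Rightarrow> 'a"
  assumes Gamma: "Gamma_semilattice \<Gamma> E \<beta>"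
begin

lemma act_closed: "\<lbrakk>g \<in> carrier \<Gamma>; e \<in> carrier E\<rbrakk> \<Longrightarrow> \<beta> g e \<in> carrier E"
  using Gamma group_action.element_image unfolding Gamma_semilattice_def by metis

lemma act_mult: "\<lbrakk>g \<in> carrier \<Gamma>; h \<in> carrier \<Gamma>; e \<in> carrier E\<rbrakk> \<Longrightarrow> \<beta> (g \<otimes>\<^bsub>\<Gamma>\<^esub> h) e = \<beta> g (\<beta> h e)"
  using Gamma group_action.composition_rule unfolding Gamma_semilattice_def by metis

lemma act_one: "e \<in> carrier E \<Longrightarrow> \<beta> \<one>\<^bsub>\<Gamma>\<^esub> e = e"
  using Gamma group_action.id_eq_one unfolding Gamma_semilattice_def by (metis restrict_apply')

lemma act_inv: "\<lbrakk>g \<in> carrier \<Gamma>; e \<in> carrier E\<rbrakk> \<Longrightarrow> \<beta> g (\<beta> (inv\<^bsub>\<Gamma>\<^esub> g) e) = e"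
  using act_mult[of g "inv\<^bsub>\<Gamma>\<^esub> g" e] act_one by simp

lemma act_inv': "\<lbrakk>g \<in> carrier \<Gamma>; e \<in> carrier E\<rbrakk> \<Longrightarrow> \<beta> (inv\<^bsub>\<Gamma>\<^esub> g) (\<beta> g e) = e"
  using act_mult[of "inv\<^bsub>\<Gamma>\<^esub> g" g e] act_one by simp

lemma act_sprod:
  "\<lbrakk>g \<in> carrier \<Gamma>; e \<in> carrier E; f \<in> carrier E\<rbrakk> \<Longrightarrow> \<beta> g (e \<odot> f) = \<beta> g e \<odot> \<beta> g f"
  using Gamma unfolding Gamma_semilattice_def by blast

text \<open>Zero is fixed although \<open>Gamma_semilattice\<close> does not say so: zero is its own
  product with the preimage \<open>?z\<close> of zero, and applying \<open>g\<close> turns this into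
  a product with zero.\<close>

lemma act_zero:
  assumes g: "g \<in> carrier \<Gamma>"
  shows "\<beta> g (szero E) = szero E"
proof -
  let ?z = "\<beta> (inv\<^bsub>\<Gamma>\<^esub> g) (szero E)"
  have z: "?z \<in> carrier E" using g by (intro act_closed) (auto simp: zero_closed)
  have "\<beta> g (szero E) = \<beta> g (szero E \<odot> ?z)" using zero[OF z] by simp
  also have "\<dots> = \<beta> g (szero E) \<odot> szero E"
    using act_sprod[OF g zero_closed z] act_inv[OF g zero_closed] by simp
  also have "\<dots> = szero E" by (rule zero_right[OF act_closed[OF g zero_closed]])
  finally show ?thesis .
qed

lemma act_nonzero: "\<lbrakk>g \<in> carrier \<Gamma>; e \<in> nonzero E\<rbrakk> \<Longrightarrow> \<beta> g e \<in> nonzero E"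
  using act_closed[of g e] act_inv'[of g e] act_zero[of "inv\<^bsub>\<Gamma>\<^esub> g"] by (auto simp: nonzero_def)

lemma ZE_action_basis:
  assumes "g \<in> carrier \<Gamma>" "e \<in> carrier E"
  shows "ZE_action E \<beta> g (basis E e) = basis E (\<beta> g e)"
proof (cases "e = szero E")
  case True
  then show ?thesis using act_zero[OF assms(1)] by (simp add: ZE_action_def basis_def)
next
  case False
  then have "e \<in> nonzero E" using assms by (simp add: nonzero_def)
  then show ?thesis
    using act_nonzero[OF assms(1)] by (simp add: ZE_action_def basis_nonzero)
qed

lemma ZE_action_alg_hom:
  assumes g: "g \<in> carrier \<Gamma>"
  shows "ZE_action E \<beta> g \<in> alg_hom (ZE E) (ZE E)"
proof (rule alg_hom_cong)
  \<comment> \<open>Using \<open>basis\<close> in place of \<open>frag_of\<close> sends zero to 0,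
    as \<open>frag_extend_alg_hom\<close> demands. On the carrier both extensions agree, because the
    action preserves non-zero elements.\<close>
  show "frag_extend (\<lambda>e. basis E (\<beta> g e)) \<in> alg_hom (ZE E) (ZE E)"
  proof (rule frag_extend_alg_hom)
    show "basis E (\<beta> g (e \<odot> f)) = basis E (\<beta> g e) \<otimes>\<^bsub>ZE E\<^esub> basis E (\<beta> g f)"
      if "e \<in> carrier E" "f \<in> carrier E" for e f
      using act_sprod[OF g that] basis_mult act_closed[OF g] that by simp
    show "basis E (\<beta> g (szero E)) = 0" by (simp add: act_zero[OF g] basis_def)
  qed (intro zero_semilattice_axioms basis_closed act_closed g)+
  show "frag_extend (\<lambda>e. basis E (\<beta> g e)) p = ZE_action E \<beta> g p" if "p \<in> carrier (ZE E)" for p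
    unfolding ZE_action_apply[OF that]
    by (rule frag_extend_cong_on[of _ "nonzero E"]) (use that act_nonzero[OF g] in \<open>auto simp: basis_nonzero\<close>)
qed (rule Z.z_algebra_axioms)

lemma ZE_action_closed:
  "\<lbrakk>g \<in> carrier \<Gamma>; p \<in> carrier (ZE E)\<rbrakk> \<Longrightarrow> ZE_action E \<beta> g p \<in> carrier (ZE E)"
  by (rule alg_hom_closed[OF ZE_action_alg_hom])

lemma ZE_action_mult:
  assumes "g \<in> carrier \<Gamma>" "h \<in> carrier \<Gamma>" "p \<in> carrier (ZE E)"
  shows "ZE_action E \<beta> (g \<otimes>\<^bsub>\<Gamma>\<^esub> h) p = ZE_action E \<beta> g (ZE_action E \<beta> h p)"
  unfolding ZE_action_apply[OF ZE_action_closed[OF assms(2,3)]]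
  unfolding ZE_action_apply[OF assms(3)] frag_extend_frag_extend frag_extend_of
  by (rule frag_extend_cong_on[of _ "nonzero E"])
    (use assms act_mult[OF assms(1,2)] in \<open>auto simp: nonzero_def\<close>)

lemma ZE_action_one:
  assumes "p \<in> carrier (ZE E)"
  shows "ZE_action E \<beta> \<one>\<^bsub>\<Gamma>\<^esub> p = p"
proof -
  have "frag_extend (\<lambda>e. frag_of (\<beta> \<one>\<^bsub>\<Gamma>\<^esub> e)) p = frag_extend frag_of p"
    by (rule frag_extend_cong_on[of _ "nonzero E"]) (use assms act_one in \<open>auto simp: nonzero_def\<close>)
  then show ?thesis by (simp only: ZE_action_apply[OF assms] frag_expansion[symmetric])
qed

text \<open>A character precomposed with the action is a character, so its value on the translate is
  prescribed by the translated top and family.\<close>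

lemma is_gap_act:
  assumes g: "g \<in> carrier \<Gamma>" and gap: "is_gap E e S x"
  shows "is_gap E (\<beta> g e) (\<beta> g ` S) (ZE_action E \<beta> g x)"
proof -
  have C: "x \<in> carrier (ZE E)" "e \<in> carrier E" "finite S" "S \<subseteq> carrier E"
    using gap by (auto simp: is_gap_def)
  have "\<kappa> (ZE_action E \<beta> g x) =
      of_bool (\<kappa> (basis E (\<beta> g e)) = 1 \<and> (\<forall>s\<in>\<beta> g ` S. \<kappa> (basis E s) \<noteq> 1))"
    if "\<kappa> \<in> characters (ZE E)" for \<kappa>
  proof -
    have "ZE_action E \<beta> g (basis E s) = basis E (\<beta> g s)" if "s \<in> S" for s
      using that C(4) ZE_action_basis[OF g] by auto
    then show ?thesis
      using is_gap_character[OF gap character_comp_alg_hom[OF ZE_action_alg_hom[OF g] that]]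
        ZE_action_basis[OF g C(2)] by simp
  qed
  moreover have "\<beta> g ` S \<subseteq> carrier E" using C(4) act_closed[OF g] by auto
  ultimately show ?thesis
    unfolding is_gap_def using C ZE_action_closed[OF g C(1)] act_closed[OF g C(2)] by simp
qed

end

lemma Gamma_semilattice_rename:
  assumes "group \<Gamma>" "Gamma_semilattice \<Gamma> E \<beta>" "inj_on r (carrier E)"
  shows "Gamma_semilattice \<Gamma> (rename r E) (rename_action r E \<beta>)"
proof -
  interpret E: group_semilattice E \<Gamma> \<beta>
    using assms unfolding group_semilattice_def group_semilattice_axioms_def Gamma_semilattice_def by blast
  have act: "rename_action r E \<beta> g (r e) = r (\<beta> g e)" if "e \<in> carrier E" for g e
    using that assms(3) by (simp add: rename_action_def)
  show ?thesis
    unfolding Gamma_semilattice_def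
  proof (intro conjI ballI)
    show "zero_semilattice (rename r E)"
      by (rule zero_semilattice_rename[OF E.zero_semilattice_axioms assms(3)])
    show "group_action \<Gamma> (carrier (rename r E)) (rename_action r E \<beta>)"
    proof (rule group_actionI[OF assms(1)])
      show "rename_action r E \<beta> g \<in> extensional (carrier (rename r E))" for g
        by (simp add: rename_action_def rename_simps)
    qed (auto simp: rename_simps act E.act_closed E.act_one E.act_mult)
    fix g x y assume "g \<in> carrier \<Gamma>" "x \<in> carrier (rename r E)" "y \<in> carrier (rename r E)"
    then show "rename_action r E \<beta> g (x \<odot>\<^bsub>rename r E\<^esub> y) =
        rename_action r E \<beta> g x \<odot>\<^bsub>rename r E\<^esub> rename_action r E \<beta> g y"
      by (auto simp: rename_simps act rename_sprod[OF assms(3)] E.closed E.act_closed E.act_sprod)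
  qed
qed

lemma rename_action_apply:
  "\<lbrakk>inj_on r (carrier E); e \<in> carrier E\<rbrakk> \<Longrightarrow> rename_action r E \<beta> g (r e) = r (\<beta> g e)"
  by (simp add: rename_action_def)

lemma acts_freely_rename:
  assumes "zero_semilattice E" "inj_on r (carrier E)" "acts_freely_on_nonzero \<Gamma> E \<beta>"
    and "\<And>g e. \<lbrakk>g \<in> carrier \<Gamma>; e \<in> carrier E\<rbrakk> \<Longrightarrow> \<beta> g e \<in> carrier E"
  shows "acts_freely_on_nonzero \<Gamma> (rename r E) (rename_action r E \<beta>)"
  unfolding acts_freely_on_nonzero_def nonzero_rename[OF assms(1,2)]
proof
  fix x assume "x \<in> r ` nonzero E"
  then obtain e where e: "e \<in> nonzero E" "x = r e" by blast
  then have C: "e \<in> carrier E" by (simp add: nonzero_def)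
  have "stabilizer \<Gamma> (rename_action r E \<beta>) x = stabilizer \<Gamma> \<beta> e"
    unfolding stabilizer_def e(2)
    using rename_action_apply[OF assms(2) C, where \<beta> = \<beta>] inj_onD[OF assms(2) _ assms(4)[OF _ C] C]
    by auto
  then show "stabilizer \<Gamma> (rename_action r E \<beta>) x = {\<one>\<^bsub>\<Gamma>\<^esub>}"
    using assms(3) e(1) by (simp add: acts_freely_on_nonzero_def)
qed

section \<open>One equivariant stage and the passage to the next level\<close>

locale equivariant_step = resolution_step E D \<phi> + group_semilattice E \<Gamma> \<beta>
  for E :: "'a semilat" (structure) and D :: "('d, 'm) ring_scheme" and \<phi>
    and \<Gamma> :: "('g, 'l) monoid_scheme" and \<beta> +
  fixes \<alpha> :: "'g \<Rightarrow> 'd \<Rightarrow> 'd"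
  assumes equivariant: "equivariant \<Gamma> (carrier (ZE E)) (ZE_action E \<beta>) \<alpha> \<phi>"
    and \<alpha>_zero: "g \<in> carrier \<Gamma> \<Longrightarrow> \<alpha> g \<zero>\<^bsub>D\<^esub> = \<zero>\<^bsub>D\<^esub>"
begin

text \<open>Translates of gaps are gaps, and equivariance keeps them in the kernel because the
  action on the target fixes zero.\<close>

lemma E_phi_act_closed:
  assumes "g \<in> carrier \<Gamma>" "x \<in> carrier (E_phi D E \<phi>)"
  shows "ZE_action E \<beta> g x \<in> carrier (E_phi D E \<phi>)"
proof -
  have "\<phi> (ZE_action E \<beta> g x) = \<alpha> g (\<phi> x)"
    using equivariant assms E_phi_closed by (simp add: equivariant_def)
  then show ?thesis
    using assms is_gap_act[OF assms(1)] \<alpha>_zero unfolding E_phi_mem by metis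
qed

lemma E_phi_action_apply:
  "x \<in> carrier (E_phi D E \<phi>) \<Longrightarrow> E_phi_action D E \<phi> \<beta> g x = ZE_action E \<beta> g x"
  by (simp add: E_phi_action_def)

lemma Gamma_semilattice_E_phi: "Gamma_semilattice \<Gamma> (E_phi D E \<phi>) (E_phi_action D E \<phi> \<beta>)"
  unfolding Gamma_semilattice_def
proof (intro conjI ballI)
  show "group_action \<Gamma> (carrier (E_phi D E \<phi>)) (E_phi_action D E \<phi> \<beta>)"
  proof (rule group_actionI[OF is_group])
    show "E_phi_action D E \<phi> \<beta> g \<in> extensional (carrier (E_phi D E \<phi>))" for g
      by (simp add: E_phi_action_def)
  qed (simp_all only: E_phi_action_apply E_phi_act_closed ZE_action_one ZE_action_mult E_phi_closed)
  fix g x y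
  assume g: "g \<in> carrier \<Gamma>" and x: "x \<in> carrier (E_phi D E \<phi>)" and y: "y \<in> carrier (E_phi D E \<phi>)"
  have xy: "x \<otimes>\<^bsub>ZE E\<^esub> y \<in> carrier (E_phi D E \<phi>)"
    using zero_semilattice.closed[OF zero_semilattice_E_phi x y] by (simp add: E_phi_simps)
  show "E_phi_action D E \<phi> \<beta> g (x \<odot>\<^bsub>E_phi D E \<phi>\<^esub> y) =
      E_phi_action D E \<phi> \<beta> g x \<odot>\<^bsub>E_phi D E \<phi>\<^esub> E_phi_action D E \<phi> \<beta> g y"
    unfolding E_phi_simps E_phi_action_apply[OF x] E_phi_action_apply[OF y] E_phi_action_apply[OF xy]
    by (rule alg_hom_mult[OF ZE_action_alg_hom[OF g] E_phi_closed[OF x] E_phi_closed[OF y]])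
qed (rule zero_semilattice_E_phi)

text \<open>The top element \<open>e\<close> of a non-zero \<open>e - \<Or>f\<^sub>j\<close> can be read off its support.\<close>

lemma acts_freely_E_phi:
  assumes free: "acts_freely_on_nonzero \<Gamma> E \<beta>"
  shows "acts_freely_on_nonzero \<Gamma> (E_phi D E \<phi>) (E_phi_action D E \<phi> \<beta>)"
  unfolding acts_freely_on_nonzero_def
proof
  fix x assume "x \<in> nonzero (E_phi D E \<phi>)"
  then have x: "x \<in> carrier (E_phi D E \<phi>)" and "x \<noteq> 0"
    by (auto simp: nonzero_def E_phi_simps)
  then obtain e S where gap: "is_gap E e S x" using E_phi_mem by blast
  obtain f and J :: "nat set" where J: "finite J" and e: "e \<in> nonzero E"
    and f: "\<And>j. j \<in> J \<Longrightarrow> f j \<in> nonzero E \<and> slat_less E (f j) e \<and> f j \<in> (\<lambda>s. e \<odot> s) ` S"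
    and x_eq: "x = frag_of e \<ominus>\<^bsub>ZE E\<^esub> big_vee (ZE E) (\<lambda>j. frag_of (f j)) J"
    by (rule is_gap_normalise[OF gap \<open>x \<noteq> 0\<close>]) blast
  \<comment> \<open>The elements strictly below \<open>e\<close> are closed under non-zero products,
    so the join is supported in \<open>L\<close> and \<open>e\<close> survives in the support of
    \<open>x\<close>.\<close>
  define L where "L = {u \<in> nonzero E. slat_less E u e}"
  have Ce: "e \<in> carrier E" using e by (simp add: nonzero_def)
  have keys: "Poly_Mapping.keys (big_vee (ZE E) (\<lambda>j. frag_of (f j)) J) \<subseteq> L"
  proof (rule keys_big_vee[OF J])
    show "f ` J \<subseteq> L" using f by (auto simp: L_def)
    show "a \<odot> b \<in> L" if "a \<in> L" "b \<in> L" "a \<odot> b \<noteq> szero E" for a b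
    proof -
      have a: "a \<in> carrier E" "a \<odot> e = a" "a \<noteq> e" and b: "b \<in> carrier E" "b \<odot> e = b"
        using that by (auto simp: L_def nonzero_def slat_less_def)
      have "a \<odot> b \<odot> e = a \<odot> b" using assoc[OF a(1) b(1) Ce] b by simp
      moreover have "a \<odot> b \<noteq> e"
      proof
        assume "a \<odot> b = e"
        then have "a \<odot> e = e" using assoc[OF a(1,1) b(1)] idem[OF a(1)] by simp
        then show False using a by simp
      qed
      ultimately show ?thesis
        using that(3) closed[OF a(1) b(1)] by (simp add: L_def nonzero_def slat_less_def)
    qed
  qed (auto simp: L_def)
  have "e \<notin> L" by (simp add: L_def slat_less_def)
  have keys_v: "Poly_Mapping.keys (big_vee (ZE E) (\<lambda>j. frag_of (f j)) J) \<subseteq> nonzero E"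
    "e \<notin> Poly_Mapping.keys (big_vee (ZE E) (\<lambda>j. frag_of (f j)) J)"
    using keys \<open>e \<notin> L\<close> by (auto simp: L_def)
  have keys_x: "Poly_Mapping.keys x \<subseteq> insert e L" "e \<in> Poly_Mapping.keys x"
    using lookup_gap[OF e keys_v] keys unfolding x_eq by (auto simp: in_keys_iff)
  \<comment> \<open>Invariance of \<open>x\<close> shows that \<open>e\<close> is the translate of
    some \<open>u\<close> in the support. Every such \<open>u\<close> is below \<open>e\<close>, so
    \<open>e = \<beta> h u\<close> is below \<open>\<beta> h e\<close>.\<close>
  have below: "\<beta> h e \<odot> e = e" if h: "h \<in> carrier \<Gamma>" "ZE_action E \<beta> h x = x" for h
  proof -
    have "x = frag_extend (\<lambda>u. frag_of (\<beta> h u)) x"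
      using h(2) ZE_action_apply[OF E_phi_closed[OF x], of \<beta> h] by simp
    then have "e \<in> (\<Union>u\<in>Poly_Mapping.keys x. Poly_Mapping.keys (frag_of (\<beta> h u)))"
      using keys_x(2) keys_frag_extend[of "\<lambda>u. frag_of (\<beta> h u)" x] by auto
    then obtain u where u: "u \<in> Poly_Mapping.keys x" "e = \<beta> h u" by auto
    then have "u \<in> carrier E" "u \<odot> e = u"
      using keys_x(1) idem[OF Ce] Ce by (auto simp: L_def slat_less_def nonzero_def)
    then have "e = e \<odot> \<beta> h e" using act_sprod[OF h(1) _ Ce, of u] u(2) by simp
    then show ?thesis using comm[OF Ce act_closed[OF h(1) Ce]] by simp
  qed
  have "g = \<one>\<^bsub>\<Gamma>\<^esub>" if g: "g \<in> carrier \<Gamma>" "ZE_action E \<beta> g x = x" for g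
  proof -
    let ?h = "inv\<^bsub>\<Gamma>\<^esub> g"
    have h: "?h \<in> carrier \<Gamma>" using g by simp
    have "ZE_action E \<beta> ?h x = x"
      using ZE_action_mult[OF h g(1) E_phi_closed[OF x]] g ZE_action_one[OF E_phi_closed[OF x]] by simp
    \<comment> \<open>For \<open>g\<close> this says that \<open>e\<close> is below its translate.
      For the inverse, apply \<open>g\<close> to get the opposite inequality; by antisymmetry
      \<open>g\<close> fixes \<open>e\<close>.\<close>
    note le = below[OF g] and ge = below[OF h this]
    have "\<beta> g e = \<beta> g (\<beta> ?h e \<odot> e)" using ge by simp
    also have "\<dots> = e \<odot> \<beta> g e"
      using act_sprod[OF g(1) act_closed[OF h Ce] Ce] act_inv[OF g(1) Ce] by simp
    also have "\<dots> = e" using le comm[OF Ce act_closed[OF g(1) Ce]] by simp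
    finally have "g \<in> stabilizer \<Gamma> \<beta> e" using g(1) by (simp add: stabilizer_def)
    then show ?thesis using free e by (auto simp: acts_freely_on_nonzero_def)
  qed
  then show "stabilizer \<Gamma> (E_phi_action D E \<phi> \<beta>) x = {\<one>\<^bsub>\<Gamma>\<^esub>}"
    using E_phi_action_apply[OF x] ZE_action_one[OF E_phi_closed[OF x]] by (auto simp: stabilizer_def)
qed

end

text \<open>The carrier type is specialised to \<open>'e tower\<close>, where \<open>encode\<close>
  leads back to the same type; this is what allows the stage to be iterated.\<close>

locale tower_step = equivariant_step E D \<phi> \<Gamma> \<beta> \<alpha>
  for E :: "'e tower semilat" (structure) and D :: "('d, 'm) ring_scheme" and \<phi>
    and \<Gamma> :: "('g, 'l) monoid_scheme" and \<beta> and \<alpha>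
begin

abbreviation next_E :: "'e tower semilat" where
  "next_E \<equiv> rename encode (E_phi D E \<phi>)"

abbreviation next_action :: "'g \<Rightarrow> 'e tower \<Rightarrow> 'e tower" where
  "next_action \<equiv> rename_action encode (E_phi D E \<phi>) (E_phi_action D E \<phi> \<beta>)"

lemma inj_on_encode: "inj_on encode (A :: ('e tower \<Rightarrow>\<^sub>0 int) set)"
  by (rule inj_on_subset[OF inj_encode subset_UNIV])

lemma Gamma_semilattice_next: "Gamma_semilattice \<Gamma> next_E next_action"
  by (rule Gamma_semilattice_rename[OF is_group Gamma_semilattice_E_phi inj_on_encode])

lemma next_semilattice: "zero_semilattice next_E"
  using Gamma_semilattice_next by (simp add: Gamma_semilattice_def)

lemma nonzero_next: "nonzero next_E = encode ` nonzero (E_phi D E \<phi>)"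
  by (rule nonzero_rename[OF zero_semilattice_E_phi inj_on_encode])

lemma acts_freely_next:
  assumes "acts_freely_on_nonzero \<Gamma> E \<beta>"
  shows "acts_freely_on_nonzero \<Gamma> next_E next_action"
  by (rule acts_freely_rename[OF zero_semilattice_E_phi inj_on_encode acts_freely_E_phi[OF assms]])
    (simp_all only: E_phi_action_apply E_phi_act_closed)

lemma res_delta_alg_hom: "res_delta \<in> alg_hom (ZE next_E) (ZE E)"
  unfolding res_delta_def
  by (rule zero_semilattice.frag_extend_alg_hom[OF next_semilattice zero_semilattice_axioms])
    (auto simp: rename_simps rename_sprod[OF inj_on_encode] E_phi_simps
      simp del: ZE_simps(1) intro: E_phi_closed)

text \<open>On generators \<open>decode\<close> intertwines the actions, since the action on
  \<open>E_phi\<close> is the restriction of \<open>ZE_action\<close>; linearity does the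
  rest.\<close>

lemma res_delta_equivariant:
  "equivariant \<Gamma> (carrier (ZE next_E)) (ZE_action next_E next_action) (ZE_action E \<beta>) res_delta"
  unfolding equivariant_def
proof (intro ballI)
  fix g p assume g: "g \<in> carrier \<Gamma>" and p: "p \<in> carrier (ZE next_E)"
  have "decode (next_action g y) = ZE_action E \<beta> g (decode y)" if y: "y \<in> nonzero next_E" for y
  proof -
    obtain x where x: "x \<in> carrier (E_phi D E \<phi>)" "y = encode x"
      using y unfolding nonzero_next by (auto simp: nonzero_def)
    then show ?thesis
      using rename_action_apply[OF inj_on_encode x(1), of "E_phi_action D E \<phi> \<beta>" g]
        E_phi_action_apply[OF x(1)] by simp
  qed
  moreover have "decode y \<in> carrier (ZE E)" if y: "y \<in> nonzero next_E" for y
  proof -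
    obtain x where "x \<in> nonzero (E_phi D E \<phi>)" "y = encode x"
      using y unfolding nonzero_next by blast
    then show ?thesis
      using E_phi_closed[of x] zero_semilattice.nonzero_closed[OF zero_semilattice_E_phi] by simp
  qed
  ultimately have "frag_extend (\<lambda>y. decode (next_action g y)) p =
      frag_extend (\<lambda>y. frag_extend (\<lambda>e. frag_of (\<beta> g e)) (decode y)) p"
    using p by (intro frag_extend_cong_on[of _ "nonzero next_E"]) (simp_all only: ZE_simps(1) mem_Collect_eq ZE_action_def restrict_apply')
  then show "res_delta (ZE_action next_E next_action g p) = ZE_action E \<beta> g (res_delta p)"
    unfolding ZE_action_apply[OF alg_hom_closed[OF res_delta_alg_hom p]]
    unfolding ZE_action_apply[OF p] res_delta_def frag_extend_frag_extend frag_extend_of .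
qed

text \<open>The image lies in the kernel because \<phi> kills each generator. Conversely it is a
  subgroup containing \<open>E_phi\<close>, and \<open>kernel_in_span\<close> is applied to a finite
  subsemilattice containing the support of the given kernel element.\<close>

lemma res_delta_exact: "res_delta ` carrier (ZE next_E) = a_kernel (ZE E) D \<phi>"
proof
  have "\<phi> (res_delta p) = \<zero>\<^bsub>D\<^esub>" if "Poly_Mapping.keys p \<subseteq> nonzero next_E" for p
    using that
  proof (induction p rule: frag_induct_on)
    case zero
    then show ?case by (simp add: res_delta_def \<phi>_zero)
  next
    case (one y)
    then show ?case
      unfolding nonzero_next using E_phi_mem by (auto simp: res_delta_def nonzero_def)
  next
    case (diff p q)
    then have C: "res_delta p \<in> carrier (ZE E)" "res_delta q \<in> carrier (ZE E)"
      using alg_hom_closed[OF res_delta_alg_hom] by simp_all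
    have "res_delta (p - q) = res_delta p \<ominus>\<^bsub>ZE E\<^esub> res_delta q"
      unfolding ZE_minus[OF C(2)] by (simp add: res_delta_def frag_extend_diff)
    then show ?case
      using D.alg_hom_minus[OF abelian_group_ZE hom C] diff
        D.minus_eq_zero_iff[OF D.zero_closed D.zero_closed] by simp
  qed
  then show "res_delta ` carrier (ZE next_E) \<subseteq> a_kernel (ZE E) D \<phi>"
    unfolding a_kernel_def' using alg_hom_closed[OF res_delta_alg_hom] by auto
next
  let ?I = "res_delta ` carrier (ZE next_E)"
  show "a_kernel (ZE E) D \<phi> \<subseteq> ?I"
  proof
    fix p assume "p \<in> a_kernel (ZE E) D \<phi>"
    then have p: "Poly_Mapping.keys p \<subseteq> nonzero E" "\<phi> p = \<zero>\<^bsub>D\<^esub>"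
      by (auto simp: a_kernel_def')
    obtain U where U: "finite U" "Poly_Mapping.keys p \<subseteq> U" "U \<subseteq> carrier E"
      "\<And>a b. \<lbrakk>a \<in> U; b \<in> U\<rbrakk> \<Longrightarrow> a \<odot> b \<in> U"
      by (rule finite_subsemilattice[of "Poly_Mapping.keys p"]) (use p in \<open>auto simp: nonzero_def\<close>)
    have keys: "Poly_Mapping.keys p \<subseteq> U \<inter> nonzero E" using U(2) p(1) by blast
    show "p \<in> ?I"
    proof (rule kernel_in_span[OF U(1,3,4) keys p(2)])
      show "0 \<in> ?I" by (rule image_eqI[of _ _ 0]) (auto simp: res_delta_def)
      show "x + y \<in> ?I" if xy: "x \<in> ?I" "y \<in> ?I" for x y
      proof -
        obtain a b where "a \<in> carrier (ZE next_E)" "b \<in> carrier (ZE next_E)" "x = res_delta a" "y = res_delta b"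
          using xy by blast
        then show ?thesis
          using abelian_group_ZE[of next_E, THEN abelian_group.axioms(1), THEN abelian_monoid.a_closed, of a b]
          by (intro image_eqI[of _ _ "a + b"]) (simp_all add: res_delta_def frag_extend_add)
      qed
      show "frag_cmul c x \<in> ?I" if x: "x \<in> ?I" for c x
      proof -
        obtain a where "a \<in> carrier (ZE next_E)" "x = res_delta a" using x by blast
        then show ?thesis
          using keys_cmul[of c a]
          by (intro image_eqI[of _ _ "frag_cmul c a"]) (auto simp: res_delta_def frag_extend_cmul)
      qed
      show "carrier (E_phi D E \<phi>) \<subseteq> ?I"
      proof
        fix x assume x: "x \<in> carrier (E_phi D E \<phi>)"
        show "x \<in> ?I"
        \<comment> \<open>The zero of \<open>E_phi\<close> is not a basis element of the next
          algebra; it is reached as the image of 0 instead.\<close>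
        proof (cases "x = 0")
          case True
          then show ?thesis using \<open>0 \<in> ?I\<close> by simp
        next
          case False
          then have "encode x \<in> nonzero next_E"
            using x unfolding nonzero_next by (simp add: nonzero_def E_phi_simps)
          then show ?thesis
            by (intro image_eqI[of _ _ "frag_of (encode x)"]) (simp_all add: res_delta_def)
        qed
      qed
    qed
  qed
qed

text \<open>Closes the recursion: the present semilattice algebra with its induced action becomes
  the target of the next stage.\<close>

lemma tower_step_next: "tower_step next_E (ZE E) res_delta \<Gamma> next_action (ZE_action E \<beta>)"
proof (intro tower_step.intro equivariant_step.intro resolution_step.intro group_semilattice.intro)
  show "resolution_step_axioms next_E (ZE E) res_delta"
    by (rule resolution_step_axioms.intro[OF res_delta_alg_hom])
  show "group_semilattice_axioms next_E \<Gamma> next_action"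
    by (rule group_semilattice_axioms.intro[OF Gamma_semilattice_next])
  show "equivariant_step_axioms next_E (ZE E) res_delta \<Gamma> next_action (ZE_action E \<beta>)"
    by (rule equivariant_step_axioms.intro[OF res_delta_equivariant]) (simp add: ZE_action_apply)
qed (rule next_semilattice function_algebra_ZE is_group)+

end

section \<open>The resolution\<close>

lemma inj_Base: "inj_on Base A"
  by (auto simp: inj_on_def)

context zero_semilattice
begin

text \<open>Uniqueness in the universal property; it reduces equivariance of the map built in
  \<open>equivariant_surjectionI\<close> to basis elements.\<close>

lemma alg_hom_eq_on_basis:
  assumes "function_algebra D" "h \<in> alg_hom (ZE E) D" "k \<in> alg_hom (ZE E) D"
    and "\<And>e. e \<in> nonzero E \<Longrightarrow> h (frag_of e) = k (frag_of e)" and p: "p \<in> carrier (ZE E)"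
  shows "h p = k p"
proof -
  interpret D: function_algebra D by fact
  from p have "Poly_Mapping.keys p \<subseteq> nonzero E" by simp
  then show ?thesis
  proof (induction p rule: frag_induct_on)
    case zero
    then show ?case
      using D.alg_hom_zero[OF abelian_group_ZE assms(2)] D.alg_hom_zero[OF abelian_group_ZE assms(3)] by simp
  next
    case (one e)
    then show ?case by (rule assms(4))
  next
    case (diff p q)
    then have C: "p \<in> carrier (ZE E)" "q \<in> carrier (ZE E)" by simp_all
    then show ?case
      using D.alg_hom_minus[OF abelian_group_ZE assms(2) C] D.alg_hom_minus[OF abelian_group_ZE assms(3) C]
        ZE_minus[OF C(2), of p] diff by simp
  qed
qed

lemma unBase_alg_hom:
  "frag_extend (\<lambda>x. frag_of (unBase x)) \<in> alg_hom (ZE (rename Base E)) (ZE E)"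
proof (rule alg_hom_cong)
  note B = zero_semilattice_rename[OF zero_semilattice_axioms inj_Base]
  \<comment> \<open>Again \<open>basis\<close> stands in for \<open>frag_of\<close>, so that zero is
    sent to 0; the two agree on non-zero elements.\<close>
  show "frag_extend (\<lambda>x. basis E (unBase x)) \<in> alg_hom (ZE (rename Base E)) (ZE E)"
    by (rule zero_semilattice.frag_extend_alg_hom[OF B zero_semilattice_axioms])
      (auto simp: rename_simps rename_sprod[OF inj_Base] basis_mult basis_def[of E "szero E"]
        simp del: ZE_simps(1) intro: basis_closed)
  show "z_algebra (ZE (rename Base E))"
    by (rule function_algebra.axioms(1)[OF zero_semilattice.function_algebra_ZE[OF B]])
  show "frag_extend (\<lambda>x. basis E (unBase x)) p = frag_extend (\<lambda>x. frag_of (unBase x)) p"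
    if "p \<in> carrier (ZE (rename Base E))" for p
    by (rule frag_extend_cong_on[of _ "nonzero (rename Base E)"])
      (use that in \<open>auto simp: nonzero_rename[OF zero_semilattice_axioms inj_Base] basis_nonzero\<close>)
qed

end

locale resolution_data = group \<Gamma> + D: function_algebra D
  for \<Gamma> :: "('g, 'l) monoid_scheme" and D :: "('d, 'm) ring_scheme" +
  fixes \<alpha> :: "'g \<Rightarrow> 'd \<Rightarrow> 'd"
  assumes action: "alg_action \<Gamma> D \<alpha>"
begin

lemma \<alpha>_alg_hom: "g \<in> carrier \<Gamma> \<Longrightarrow> \<alpha> g \<in> alg_hom D D"
  using action by (simp add: alg_action_def)

lemma \<alpha>_closed: "\<lbrakk>g \<in> carrier \<Gamma>; d \<in> carrier D\<rbrakk> \<Longrightarrow> \<alpha> g d \<in> carrier D"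
  by (rule alg_hom_closed[OF \<alpha>_alg_hom])

lemma \<alpha>_zero: "g \<in> carrier \<Gamma> \<Longrightarrow> \<alpha> g \<zero>\<^bsub>D\<^esub> = \<zero>\<^bsub>D\<^esub>"
  by (rule D.alg_hom_zero[OF D.abelian_group_axioms \<alpha>_alg_hom])

lemma \<alpha>_act: "\<lbrakk>g \<in> carrier \<Gamma>; h \<in> carrier \<Gamma>; d \<in> carrier D\<rbrakk> \<Longrightarrow> \<alpha> (g \<otimes>\<^bsub>\<Gamma>\<^esub> h) d = \<alpha> g (\<alpha> h d)"
  using action group_action.composition_rule unfolding alg_action_def by metis

lemma \<alpha>_one: "d \<in> carrier D \<Longrightarrow> \<alpha> \<one>\<^bsub>\<Gamma>\<^esub> d = d"
  using action group_action.id_eq_one unfolding alg_action_def by (metis restrict_apply')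

text \<open>Apply the inverse group element. This keeps \<open>free_action\<close> compatible with
  the rule that exactly the zero idempotent carries the empty set.\<close>

lemma \<alpha>_eq_zero_iff:
  assumes "g \<in> carrier \<Gamma>" "d \<in> carrier D"
  shows "\<alpha> g d = \<zero>\<^bsub>D\<^esub> \<longleftrightarrow> d = \<zero>\<^bsub>D\<^esub>"
  using \<alpha>_act[of "inv\<^bsub>\<Gamma>\<^esub> g" g d] \<alpha>_zero[of "inv\<^bsub>\<Gamma>\<^esub> g"] \<alpha>_zero[OF assms(1)] \<alpha>_one assms by auto

text \<open>Level zero differs from \<open>E\<close> only by the constructor \<open>Base\<close>, so
  the properties of \<phi> are transported along the map induced by \<open>unBase\<close>.\<close>

lemma tower_step_base:
  assumes "equivariant_surjection \<Gamma> D \<alpha> E \<beta> \<phi>"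
  shows "tower_step (rename Base E) D (res_eps \<phi>) \<Gamma> (rename_action Base E \<beta>) \<alpha>"
    and "res_eps \<phi> ` carrier (ZE (rename Base E)) = carrier D"
proof -
  have E: "Gamma_semilattice \<Gamma> E \<beta>" and \<phi>: "\<phi> \<in> alg_hom (ZE E) D"
    and equi: "equivariant \<Gamma> (carrier (ZE E)) (ZE_action E \<beta>) \<alpha> \<phi>"
    and surj: "\<phi> ` carrier (ZE E) = carrier D"
    using assms by (simp_all add: equivariant_surjection_def)
  interpret E: group_semilattice E \<Gamma> \<beta>
    using E group_axioms
    unfolding group_semilattice_def group_semilattice_axioms_def Gamma_semilattice_def by blast
  let ?E = "rename Base E" and ?\<beta> = "rename_action Base E \<beta>"
  let ?u = "frag_extend (\<lambda>x. frag_of (unBase x))"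
  note B = Gamma_semilattice_rename[OF is_group E inj_Base]
  interpret B: group_semilattice ?E \<Gamma> ?\<beta>
    using B group_axioms
    unfolding group_semilattice_def group_semilattice_axioms_def Gamma_semilattice_def by blast
  have hom: "res_eps \<phi> \<in> alg_hom (ZE ?E) D"
    using alg_hom_comp[OF E.unBase_alg_hom \<phi>] unfolding res_eps_def[abs_def] .
  have u: "?u p \<in> carrier (ZE E)" if "p \<in> carrier (ZE ?E)" for p
    by (rule alg_hom_closed[OF E.unBase_alg_hom that])
  have u_equi: "?u (ZE_action ?E ?\<beta> g p) = ZE_action E \<beta> g (?u p)"
    if g: "g \<in> carrier \<Gamma>" and p: "p \<in> carrier (ZE ?E)" for g p
    unfolding ZE_action_apply[OF u[OF p]]
    unfolding ZE_action_apply[OF p] frag_extend_frag_extend frag_extend_of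
  proof (rule frag_extend_cong_on[of _ "nonzero ?E"])
    show "Poly_Mapping.keys p \<subseteq> nonzero ?E" using p by simp
    fix x assume "x \<in> nonzero ?E"
    then obtain e where "e \<in> carrier E" "x = Base e"
      unfolding nonzero_rename[OF E.zero_semilattice_axioms inj_Base]
      using E.nonzero_closed by blast
    then show "frag_of (unBase (?\<beta> g x)) = frag_of (\<beta> g (unBase x))"
      using rename_action_apply[OF inj_Base, of e E \<beta> g] by simp
  qed
  have equi': "equivariant \<Gamma> (carrier (ZE ?E)) (ZE_action ?E ?\<beta>) \<alpha> (res_eps \<phi>)"
    using equi u u_equi unfolding equivariant_def res_eps_def by metis
  show "tower_step ?E D (res_eps \<phi>) \<Gamma> ?\<beta> \<alpha>"
    by (intro tower_step.intro equivariant_step.intro resolution_step.intro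
        resolution_step_axioms.intro equivariant_step_axioms.intro B.zero_semilattice_axioms
        D.function_algebra_axioms hom B.group_semilattice_axioms equi' \<alpha>_zero)
  show "res_eps \<phi> ` carrier (ZE ?E) = carrier D"
  proof
    show "res_eps \<phi> ` carrier (ZE ?E) \<subseteq> carrier D" using alg_hom_closed[OF hom] by blast
    show "carrier D \<subseteq> res_eps \<phi> ` carrier (ZE ?E)"
    proof
      fix d assume "d \<in> carrier D"
      then obtain p where p: "p \<in> carrier (ZE E)" "d = \<phi> p" using surj by blast
      let ?p = "frag_extend (\<lambda>e. frag_of (Base e)) p"
      have "?p \<in> carrier (ZE ?E)"
        by (rule frag_extend_closed[of p "nonzero E"])
          (use p in \<open>auto simp: nonzero_rename[OF E.zero_semilattice_axioms inj_Base]\<close>)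
      moreover have "?u ?p = p"
      proof -
        have "?u ?p = frag_extend frag_of p" by (simp add: frag_extend_frag_extend)
        then show ?thesis by (simp only: frag_expansion[symmetric])
      qed
      ultimately show "d \<in> res_eps \<phi> ` carrier (ZE ?E)"
        using p(2) by (intro image_eqI[of _ _ ?p]) (simp_all add: res_eps_def)
    qed
  qed
qed

text \<open>The index starts at level one because only from there on is the target a semilattice
  algebra and the map \<open>res_delta\<close>; level zero maps to \<open>D\<close> by
  \<open>res_eps \<phi>\<close>.\<close>

lemma tower_step_Suc:
  assumes "equivariant_surjection \<Gamma> D \<alpha> E \<beta> \<phi>"
  shows "tower_step (res_E D E \<phi> (Suc k)) (ZE (res_E D E \<phi> k)) res_delta \<Gamma>
    (res_action D E \<phi> \<beta> (Suc k)) (ZE_action (res_E D E \<phi> k) (res_action D E \<phi> \<beta> k))"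
proof (induction k)
  case 0
  then show ?case
    using tower_step.tower_step_next[OF tower_step_base(1)[OF assms]] by simp
next
  case (Suc k)
  then show ?case
    using tower_step.tower_step_next[OF Suc] by simp
qed

lemma resolution:
  assumes "equivariant_surjection \<Gamma> D \<alpha> E \<beta> \<phi>"
  shows "algebraic_independent_resolution \<Gamma> D \<alpha>
    (res_E D E \<phi>) (res_action D E \<phi> \<beta>) (res_eps \<phi>) (\<lambda>k. res_delta)"
proof -
  let ?E = "res_E D E \<phi>" and ?\<beta> = "res_action D E \<phi> \<beta>"
  interpret T0: tower_step "?E 0" D "res_eps \<phi>" \<Gamma> "?\<beta> 0" \<alpha>
    using tower_step_base(1)[OF assms] by simp
  note T = tower_step_Suc[OF assms]
  have Gamma: "Gamma_semilattice \<Gamma> (?E k) (?\<beta> k)" for k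
  proof (cases k)
    case 0
    then show ?thesis using T0.Gamma by simp
  next
    case (Suc n)
    interpret tower_step "?E (Suc n)" "ZE (?E n)" res_delta \<Gamma> "?\<beta> (Suc n)" "ZE_action (?E n) (?\<beta> n)"
      by (rule T)
    show ?thesis using Gamma Suc by simp
  qed
  have delta: "res_delta \<in> alg_hom (ZE (?E (Suc k))) (ZE (?E k)) \<and>
      equivariant \<Gamma> (carrier (ZE (?E (Suc k)))) (ZE_action (?E (Suc k)) (?\<beta> (Suc k)))
        (ZE_action (?E k) (?\<beta> k)) res_delta" for k
  proof -
    interpret T: tower_step "?E (Suc k)" "ZE (?E k)" res_delta \<Gamma> "?\<beta> (Suc k)" "ZE_action (?E k) (?\<beta> k)"
      by (rule T)
    show ?thesis using T.hom T.equivariant by blast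
  qed
  have exact: "res_delta ` carrier (ZE (?E (Suc (Suc k)))) =
      a_kernel (ZE (?E (Suc k))) (ZE (?E k)) res_delta" for k
    using tower_step.res_delta_exact[OF T[of k]] by simp
  have exact0: "res_delta ` carrier (ZE (?E 1)) = a_kernel (ZE (?E 0)) D (res_eps \<phi>)"
    using T0.res_delta_exact by simp
  have surj: "res_eps \<phi> ` carrier (ZE (?E 0)) = carrier D"
    using tower_step_base(2)[OF assms] by simp
  show ?thesis
    unfolding algebraic_independent_resolution_def
    by (intro conjI allI Gamma delta[THEN conjunct1] delta[THEN conjunct2] exact exact0 surj
        T0.hom T0.equivariant)
qed

lemma resolution_acts_freely:
  assumes "equivariant_surjection \<Gamma> D \<alpha> E \<beta> \<phi>" "acts_freely_on_nonzero \<Gamma> E \<beta>"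
  shows "acts_freely_on_nonzero \<Gamma> (res_E D E \<phi> k) (res_action D E \<phi> \<beta> k)"
proof (induction k)
  case 0
  have E: "Gamma_semilattice \<Gamma> E \<beta>" using assms(1) by (simp add: equivariant_surjection_def)
  then interpret E: group_semilattice E \<Gamma> \<beta>
    using group_axioms
    unfolding group_semilattice_def group_semilattice_axioms_def Gamma_semilattice_def by blast
  show ?case
    using acts_freely_rename[OF E.zero_semilattice_axioms inj_Base assms(2) E.act_closed] by simp
next
  case IH: (Suc k)
  show ?case
  \<comment> \<open>Level one arises from the base stage with target \<open>D\<close>, all later
    levels from \<open>tower_step_Suc\<close>.\<close>
  proof (cases k)
    case 0
    then show ?thesis
      using tower_step.acts_freely_next[OF tower_step_base(1)[OF assms(1)]] IH by simp
  next
    case (Suc n)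
    then show ?thesis
      using tower_step.acts_freely_next[OF tower_step_Suc[OF assms(1), of n]] IH by simp
  qed
qed

text \<open>Common criterion for both models of \<open>E\<close>. The extension of \<psi> is onto
  because its image is a subalgebra containing every idempotent, hence a generating set of
  \<open>D\<close>.\<close>

lemma equivariant_surjectionI:
  assumes gen: "generated_by_commuting_idempotents D" and E: "Gamma_semilattice \<Gamma> E \<beta>"
    and closed: "\<And>e. e \<in> carrier E \<Longrightarrow> \<psi> e \<in> carrier D"
    and mult: "\<And>e f. \<lbrakk>e \<in> carrier E; f \<in> carrier E\<rbrakk> \<Longrightarrow> \<psi> (e \<odot>\<^bsub>E\<^esub> f) = \<psi> e \<otimes>\<^bsub>D\<^esub> \<psi> f"
    and zero: "\<psi> (szero E) = \<zero>\<^bsub>D\<^esub>"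
    and act: "\<And>g e. \<lbrakk>g \<in> carrier \<Gamma>; e \<in> carrier E\<rbrakk> \<Longrightarrow> \<psi> (\<beta> g e) = \<alpha> g (\<psi> e)"
    and idem: "\<And>d. \<lbrakk>d \<in> carrier D; d \<otimes>\<^bsub>D\<^esub> d = d\<rbrakk> \<Longrightarrow> d \<in> \<psi> ` carrier E"
  obtains \<phi> where "equivariant_surjection \<Gamma> D \<alpha> E \<beta> \<phi>"
proof -
  interpret E: group_semilattice E \<Gamma> \<beta>
    using group_axioms E
    unfolding group_semilattice_def group_semilattice_axioms_def Gamma_semilattice_def by blast
  \<comment> \<open>The additive extension comes from the universal property of free abelian groups;
    multiplicativity and equivariance are then checked on the basis.\<close>
  have "comm_group (add_monoid D)" by (rule D.a_comm_group)
  moreover have "\<psi> ` nonzero E \<subseteq> carrier (add_monoid D)" using closed E.nonzero_closed by auto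
  ultimately obtain h where h: "h \<in> hom (free_Abelian_group (nonzero E)) (add_monoid D)"
    and h_of: "\<And>e. e \<in> nonzero E \<Longrightarrow> h (frag_of e) = \<psi> e"
    by (rule comm_group.free_Abelian_group_universal) blast
  have h_closed: "h p \<in> carrier D" if "p \<in> carrier (ZE E)" for p
    using h that by (auto simp: hom_def Pi_iff)
  have h_add: "h (p + q) = h p \<oplus>\<^bsub>D\<^esub> h q" if "p \<in> carrier (ZE E)" "q \<in> carrier (ZE E)" for p q
    using h that by (auto simp: hom_def)
  have h_zero: "h 0 = \<zero>\<^bsub>D\<^esub>"
    using h_add[of 0 0] h_closed[of 0] D.add.r_cancel_one[of "h 0" "h 0"] by simp
  have h_basis: "h (basis E e) = \<psi> e" if "e \<in> carrier E" for e
    using that h_of[of e] h_zero zero by (auto simp: basis_def nonzero_def)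
  have hom: "h \<in> alg_hom (ZE E) D"
  proof (rule E.alg_hom_ZE_I[OF D.function_algebra_axioms h_closed h_add])
    fix e f assume "e \<in> nonzero E" "f \<in> nonzero E"
    then show "h (basis E (e \<odot>\<^bsub>E\<^esub> f)) = h (frag_of e) \<otimes>\<^bsub>D\<^esub> h (frag_of f)"
      using h_basis E.closed mult h_of E.nonzero_closed by simp
  qed
  have "h (ZE_action E \<beta> g p) = \<alpha> g (h p)" if g: "g \<in> carrier \<Gamma>" and p: "p \<in> carrier (ZE E)" for g p
  proof (rule E.alg_hom_eq_on_basis[OF D.function_algebra_axioms _ _ _ p])
    show "(\<lambda>p. h (ZE_action E \<beta> g p)) \<in> alg_hom (ZE E) D"
      by (rule alg_hom_comp[OF E.ZE_action_alg_hom[OF g] hom])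
    show "(\<lambda>p. \<alpha> g (h p)) \<in> alg_hom (ZE E) D"
      by (rule alg_hom_comp[OF hom \<alpha>_alg_hom[OF g]])
    fix e assume e: "e \<in> nonzero E"
    then show "h (ZE_action E \<beta> g (frag_of e)) = \<alpha> g (h (frag_of e))"
      using E.ZE_action_basis[OF g, of e] h_basis E.act_closed[OF g, of e] act[OF g] h_of
        E.nonzero_closed by (simp add: basis_nonzero)
  qed
  then have equi: "equivariant \<Gamma> (carrier (ZE E)) (ZE_action E \<beta>) \<alpha> h"
    unfolding equivariant_def by blast
  let ?I = "h ` carrier (ZE E)"
  have sub: "subalgebra_of ?I D"
    unfolding subalgebra_of_def
  proof (intro conjI ballI)
    show "?I \<subseteq> carrier D" using h_closed by blast
    show "\<zero>\<^bsub>D\<^esub> \<in> ?I" using h_zero by (intro image_eqI[of _ _ 0]) auto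
    fix x y assume "x \<in> ?I" "y \<in> ?I"
    then obtain p q where p: "p \<in> carrier (ZE E)" "x = h p" and q: "q \<in> carrier (ZE E)" "y = h q"
      by blast
    show "x \<ominus>\<^bsub>D\<^esub> y \<in> ?I"
      using D.alg_hom_minus[OF abelian_group_ZE hom p(1) q(1)] E.Z.minus_closed[OF p(1) q(1)] p q
      by (metis image_eqI)
    show "x \<otimes>\<^bsub>D\<^esub> y \<in> ?I"
      using alg_hom_mult[OF hom p(1) q(1)] E.Z.m_closed[OF p(1) q(1)] p q
      by (metis image_eqI)
  qed
  obtain P where P: "P \<subseteq> carrier D" "\<forall>p\<in>P. p \<otimes>\<^bsub>D\<^esub> p = p"
    "\<Inter>{S. subalgebra_of S D \<and> P \<subseteq> S} = carrier D"
    using gen unfolding generated_by_commuting_idempotents_def by blast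
  have "P \<subseteq> ?I"
  proof
    fix d assume "d \<in> P"
    then obtain e where "e \<in> carrier E" "d = \<psi> e" using P idem by blast
    then show "d \<in> ?I" using h_basis[of e] basis_closed[of e E] by (metis image_eqI)
  qed
  then have "carrier D \<subseteq> ?I" using P(3) sub by blast
  then have "?I = carrier D" using h_closed by blast
  then show thesis
    using that E hom equi by (simp add: equivariant_surjection_def)
qed

end

section \<open>Two models of \<open>E\<close>: idempotents, and idempotents paired with finite
  subsets of the group\<close>

context resolution_data
begin

lemma \<alpha>_mult: "\<lbrakk>g \<in> carrier \<Gamma>; d \<in> carrier D; f \<in> carrier D\<rbrakk> \<Longrightarrow> \<alpha> g (d \<otimes>\<^bsub>D\<^esub> f) = \<alpha> g d \<otimes>\<^bsub>D\<^esub> \<alpha> g f"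
  by (rule alg_hom_mult[OF \<alpha>_alg_hom])

lemma \<alpha>_idem: "\<lbrakk>g \<in> carrier \<Gamma>; d \<in> carrier D; d \<otimes>\<^bsub>D\<^esub> d = d\<rbrakk> \<Longrightarrow> \<alpha> g d \<otimes>\<^bsub>D\<^esub> \<alpha> g d = \<alpha> g d"
  using \<alpha>_mult[of g d d] by simp

definition idem_semilattice :: "'d semilat" where
  "idem_semilattice = \<lparr>carrier = {d \<in> carrier D. d \<otimes>\<^bsub>D\<^esub> d = d}, sprod = (\<otimes>\<^bsub>D\<^esub>), szero = \<zero>\<^bsub>D\<^esub>\<rparr>"

lemma Gamma_semilattice_idem:
  "Gamma_semilattice \<Gamma> idem_semilattice (\<lambda>g. restrict (\<alpha> g) (carrier idem_semilattice))"
  unfolding Gamma_semilattice_def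
proof (intro conjI ballI)
  show "zero_semilattice idem_semilattice"
    by unfold_locales
      (auto simp: idem_semilattice_def D.m_closed D.idem_mult D.mult_zero_left intro: D.m_comm D.m_assoc)
  show "group_action \<Gamma> (carrier idem_semilattice) (\<lambda>g. restrict (\<alpha> g) (carrier idem_semilattice))"
    by (rule group_actionI[OF is_group])
      (simp_all add: idem_semilattice_def \<alpha>_closed \<alpha>_idem \<alpha>_one \<alpha>_act)
qed (simp add: idem_semilattice_def \<alpha>_mult D.idem_mult D.m_closed)

lemma idem_equivariant_surjection:
  assumes "generated_by_commuting_idempotents D"
  obtains \<phi> where "equivariant_surjection \<Gamma> D \<alpha> idem_semilattice
    (\<lambda>g. restrict (\<alpha> g) (carrier idem_semilattice)) \<phi>"
  by (rule equivariant_surjectionI[OF assms Gamma_semilattice_idem, of "\<lambda>d. d"])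
    (auto simp: idem_semilattice_def)

text \<open>When the idempotents multiply to zero the set component is reset to the empty set, so
  that all such products are the one zero element.\<close>

definition free_prod :: "'g set \<times> 'd \<Rightarrow> 'g set \<times> 'd \<Rightarrow> 'g set \<times> 'd" where
  "free_prod x y = (if snd x \<otimes>\<^bsub>D\<^esub> snd y = \<zero>\<^bsub>D\<^esub> then {} else fst x \<union> fst y, snd x \<otimes>\<^bsub>D\<^esub> snd y)"

definition free_semilattice :: "('g set \<times> 'd) semilat" where
  "free_semilattice = \<lparr>carrier = insert ({}, \<zero>\<^bsub>D\<^esub>) {(F, d). finite F \<and> F \<noteq> {} \<and> F \<subseteq> carrier \<Gamma> \<and>
       d \<in> carrier D \<and> d \<otimes>\<^bsub>D\<^esub> d = d \<and> d \<noteq> \<zero>\<^bsub>D\<^esub>},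
     sprod = free_prod, szero = ({}, \<zero>\<^bsub>D\<^esub>)\<rparr>"

definition free_action :: "'g \<Rightarrow> 'g set \<times> 'd \<Rightarrow> 'g set \<times> 'd" where
  "free_action g = restrict (\<lambda>x. ((\<lambda>h. g \<otimes>\<^bsub>\<Gamma>\<^esub> h) ` fst x, \<alpha> g (snd x))) (carrier free_semilattice)"

text \<open>Treats zero and non-zero elements uniformly by one condition: the set component is empty
  exactly when the idempotent is zero.\<close>

lemma free_semilattice_mem:
  "x \<in> carrier free_semilattice \<longleftrightarrow> finite (fst x) \<and> fst x \<subseteq> carrier \<Gamma> \<and>
     (fst x = {} \<longleftrightarrow> snd x = \<zero>\<^bsub>D\<^esub>) \<and> snd x \<in> carrier D \<and> snd x \<otimes>\<^bsub>D\<^esub> snd x = snd x"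
  by (cases x) (auto simp: free_semilattice_def D.mult_zero_left)

lemma free_semilattice_simps: "sprod free_semilattice = free_prod" "szero free_semilattice = ({}, \<zero>\<^bsub>D\<^esub>)"
  by (simp_all add: free_semilattice_def)

lemma free_prod_closed:
  assumes "x \<in> carrier free_semilattice" "y \<in> carrier free_semilattice"
  shows "free_prod x y \<in> carrier free_semilattice"
  using assms unfolding free_semilattice_mem
  by (auto simp: free_prod_def D.m_closed D.idem_mult D.mult_zero_left)

text \<open>If a partial product of the idempotents vanishes, so does the triple product, and both
  bracketings carry the empty set; otherwise associativity of union suffices.\<close>

lemma free_prod_assoc:
  assumes "x \<in> carrier free_semilattice" "y \<in> carrier free_semilattice" "z \<in> carrier free_semilattice"
  shows "free_prod (free_prod x y) z = free_prod x (free_prod y z)"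
proof -
  have C: "snd x \<in> carrier D" "snd y \<in> carrier D" "snd z \<in> carrier D"
    using assms by (simp_all add: free_semilattice_mem)
  note eq = D.m_assoc[OF C]
  have "snd x \<otimes>\<^bsub>D\<^esub> (snd y \<otimes>\<^bsub>D\<^esub> snd z) = \<zero>\<^bsub>D\<^esub>"
    if "snd x \<otimes>\<^bsub>D\<^esub> snd y = \<zero>\<^bsub>D\<^esub> \<or> snd y \<otimes>\<^bsub>D\<^esub> snd z = \<zero>\<^bsub>D\<^esub>"
    using that eq[symmetric] C D.mult_zero_left D.mult_zero_right by auto
  then show ?thesis by (auto simp: free_prod_def eq)
qed

lemma free_action_apply:
  "x \<in> carrier free_semilattice \<Longrightarrow> free_action g x = ((\<lambda>h. g \<otimes>\<^bsub>\<Gamma>\<^esub> h) ` fst x, \<alpha> g (snd x))"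
  by (simp add: free_action_def)

lemma free_action_closed:
  "\<lbrakk>g \<in> carrier \<Gamma>; x \<in> carrier free_semilattice\<rbrakk> \<Longrightarrow> free_action g x \<in> carrier free_semilattice"
  unfolding free_action_apply unfolding free_semilattice_mem
  by (auto simp: \<alpha>_closed \<alpha>_idem \<alpha>_eq_zero_iff)

lemma free_action_one:
  assumes x: "x \<in> carrier free_semilattice"
  shows "free_action \<one>\<^bsub>\<Gamma>\<^esub> x = x"
proof -
  have "(\<lambda>h. \<one>\<^bsub>\<Gamma>\<^esub> \<otimes>\<^bsub>\<Gamma>\<^esub> h) ` fst x = (\<lambda>h. h) ` fst x"
    by (rule image_cong) (use x in \<open>auto simp: free_semilattice_mem\<close>)
  then show ?thesis
    using x \<alpha>_one[of "snd x"] by (simp add: free_action_apply free_semilattice_mem)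
qed

lemma Gamma_semilattice_free: "Gamma_semilattice \<Gamma> free_semilattice free_action"
  unfolding Gamma_semilattice_def
proof (intro conjI ballI)
  show "zero_semilattice free_semilattice"
  proof (unfold_locales, unfold free_semilattice_simps)
    fix x y assume xy: "x \<in> carrier free_semilattice" "y \<in> carrier free_semilattice"
    then show "free_prod x y = free_prod y x"
      using D.m_comm[of "snd x" "snd y"] by (auto simp: free_semilattice_mem free_prod_def)
    show "free_prod x x = x" "free_prod ({}, \<zero>\<^bsub>D\<^esub>) x = ({}, \<zero>\<^bsub>D\<^esub>)"
      using xy(1) by (auto simp: free_semilattice_mem free_prod_def D.mult_zero_left intro: prod_eqI)
    show "free_prod x y \<in> carrier free_semilattice" by (rule free_prod_closed[OF xy])
    fix z assume "z \<in> carrier free_semilattice"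
    then show "free_prod (free_prod x y) z = free_prod x (free_prod y z)"
      by (rule free_prod_assoc[OF xy])
  qed (simp add: free_semilattice_mem D.mult_zero_left)
  show "group_action \<Gamma> (carrier free_semilattice) free_action"
  proof (rule group_actionI[OF is_group])
    fix g x assume "g \<in> carrier \<Gamma>" "x \<in> carrier free_semilattice"
    then show "free_action g x \<in> carrier free_semilattice" by (rule free_action_closed)
  next
    fix x assume x: "x \<in> carrier free_semilattice"
    show "free_action \<one>\<^bsub>\<Gamma>\<^esub> x = x" by (rule free_action_one[OF x])
  next
    fix g h x assume g: "g \<in> carrier \<Gamma>" and h: "h \<in> carrier \<Gamma>" and x: "x \<in> carrier free_semilattice"
    have "(\<lambda>k. g \<otimes>\<^bsub>\<Gamma>\<^esub> h \<otimes>\<^bsub>\<Gamma>\<^esub> k) ` fst x = (\<lambda>k. g \<otimes>\<^bsub>\<Gamma>\<^esub> k) ` (\<lambda>k. h \<otimes>\<^bsub>\<Gamma>\<^esub> k) ` fst x"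
      unfolding image_image using g h x
      by (intro image_cong refl) (auto simp: m_assoc free_semilattice_mem)
    then show "free_action (g \<otimes>\<^bsub>\<Gamma>\<^esub> h) x = free_action g (free_action h x)"
      using \<alpha>_act[OF g h, of "snd x"] x
      unfolding free_action_apply[OF free_action_closed[OF h x]]
      unfolding free_action_apply[OF x] by (simp add: free_semilattice_mem)
  qed (simp add: free_action_def)
  fix g x y
  assume g: "g \<in> carrier \<Gamma>" and x: "x \<in> carrier free_semilattice" and y: "y \<in> carrier free_semilattice"
  have C: "snd x \<in> carrier D" "snd y \<in> carrier D" using x y by (simp_all add: free_semilattice_mem)
  show "free_action g (x \<odot>\<^bsub>free_semilattice\<^esub> y) = free_action g x \<odot>\<^bsub>free_semilattice\<^esub> free_action g y"
    unfolding free_semilattice_simps free_action_apply[OF x] free_action_apply[OF y]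
      free_action_apply[OF free_prod_closed[OF x y]]
    using \<alpha>_mult[OF g C] \<alpha>_eq_zero_iff[OF g D.m_closed[OF C]] by (auto simp: free_prod_def)
qed

lemma free_equivariant_surjection:
  assumes "generated_by_commuting_idempotents D"
  obtains \<phi> where "equivariant_surjection \<Gamma> D \<alpha> free_semilattice free_action \<phi>"
proof (rule equivariant_surjectionI[OF assms Gamma_semilattice_free, of snd])
  fix d assume "d \<in> carrier D" "d \<otimes>\<^bsub>D\<^esub> d = d"
  \<comment> \<open>The zero idempotent must carry the empty set; over a non-zero \<open>d\<close>
    the singleton of the group unit is chosen.\<close>
  then show "d \<in> snd ` carrier free_semilattice"
    by (intro image_eqI[of _ _ "(if d = \<zero>\<^bsub>D\<^esub> then {} else {\<one>\<^bsub>\<Gamma>\<^esub>}, d)"]) (auto simp: free_semilattice_mem)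
qed (auto simp: free_semilattice_mem free_semilattice_simps free_prod_def free_action_apply)

end

text \<open>The powers of \<open>g\<close> move a point \<open>x\<close> of \<open>F\<close> within
  the finite set \<open>F\<close>, so two different exponents give the same point. Cancelling
  \<open>x\<close> leaves a positive power of \<open>g\<close> equal to the unit.\<close>

lemma (in group) torsion_free_stabilizer_finite:
  assumes "torsion_free_group G" "g \<in> carrier G" "finite F" "F \<noteq> {}" "F \<subseteq> carrier G"
    and fixed: "(\<lambda>h. g \<otimes> h) ` F = F"
  shows "g = \<one>"
proof -
  obtain x where x: "x \<in> F" "x \<in> carrier G" using assms by blast
  have F: "g [^] n \<otimes> x \<in> F" for n :: nat
  proof (induction n)
    case (Suc n)
    have "g \<otimes> (g [^] n \<otimes> x) \<in> F" using Suc fixed by blast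
    then show ?case
      using assms(2) x nat_pow_Suc2[OF assms(2), of n] by (simp add: m_assoc del: nat_pow_Suc)
  qed (use x in simp)
  have "\<not> inj (\<lambda>n::nat. g [^] n \<otimes> x)"
    using F finite_subset[of "range (\<lambda>n::nat. g [^] n \<otimes> x)" F] assms(3) range_inj_infinite by blast
  then obtain m n :: nat where "m \<noteq> n" "g [^] m \<otimes> x = g [^] n \<otimes> x"
    by (auto simp: inj_def)
  moreover from this have "g [^] m = g [^] n" using x assms(2) by simp
  ultimately obtain m n :: nat where "m < n" "g [^] n = g [^] m"
    by (metis nat_neq_iff)
  then have "g [^] (n - m) = \<one>" "n - m > 0"
    using pow_eq_div2 assms(2) by auto
  then show ?thesis using assms(1,2) unfolding torsion_free_group_def by blast
qed

text \<open>An element fixing a pair fixes its set component, which is finite, and non-empty for a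
  non-zero pair.\<close>

lemma (in resolution_data) free_action_free:
  assumes "torsion_free_group \<Gamma>"
  shows "acts_freely_on_nonzero \<Gamma> free_semilattice free_action"
  unfolding acts_freely_on_nonzero_def
proof
  fix x assume "x \<in> nonzero free_semilattice"
  then have x: "x \<in> carrier free_semilattice" "fst x \<noteq> {}"
    by (auto simp: nonzero_def free_semilattice_def)
  have F: "finite (fst x)" "fst x \<subseteq> carrier \<Gamma>" using x(1) by (simp_all add: free_semilattice_mem)
  have "g = \<one>\<^bsub>\<Gamma>\<^esub>" if "g \<in> carrier \<Gamma>" "free_action g x = x" for g
    using torsion_free_stabilizer_finite[OF assms that(1) F(1) x(2) F(2)] that(2)
    by (metis free_action_apply[OF x(1)] fst_conv)
  moreover have "free_action \<one>\<^bsub>\<Gamma>\<^esub> x = x" by (rule free_action_one[OF x(1)])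
  ultimately show "stabilizer \<Gamma> free_action x = {\<one>\<^bsub>\<Gamma>\<^esub>}"
    by (auto simp: stabilizer_def)
qed

text \<open>Point evaluations pulled back along the isomorphism are characters and separate the
  elements of \<open>D\<close>. Points outside the space give the zero map, which
  \<open>characters\<close> admits.\<close>

lemma function_algebra_of_isomorphic:
  assumes "z_algebra D" "alg_isomorphic D (C0_int X)"
  shows "function_algebra D"
proof -
  interpret z_algebra D by fact
  obtain h where h: "h \<in> alg_hom D (C0_int X)" and bij: "bij_betw h (carrier D) (carrier (C0_int X))"
    using assms(2) by (auto simp: alg_isomorphic_def)
  have char: "(\<lambda>d. h d w) \<in> characters D" for w
    using h by (auto simp: characters_def alg_hom_def C0_int_def)
  show ?thesis
  proof (intro function_algebra.intro assms(1) function_algebra_axioms.intro)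
    fix x y assume x: "x \<in> carrier D" and y: "y \<in> carrier D"
      and eq: "\<And>\<kappa>. \<kappa> \<in> characters D \<Longrightarrow> \<kappa> x = \<kappa> y"
    have "h x = h y" using eq[OF char] by (intro ext)
    then show "x = y" using bij x y by (auto simp: bij_betw_def inj_on_def)
  qed
qed

text \<open>The types of \<open>E\<close> reflect the witnesses: idempotents of \<open>D\<close> for
  plain existence, and finite sets of group elements paired with idempotents for freeness. The
  resolution statement holds for \<open>E\<close> over an arbitrary type \<open>'e\<close>.\<close>

theorem proposition3p5:
  fixes \<Gamma> :: "'g monoid" and D :: "'d ring" and \<alpha> :: "'g \<Rightarrow> 'd \<Rightarrow> 'd"
    and \<Omega> :: "'w topology"
  assumes "group \<Gamma>"
    and "z_algebra D"
    and "generated_by_commuting_idempotents D"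
    and "Hausdorff_space \<Omega>" and "locally_compact_space \<Omega>" and "totally_disconnected_space \<Omega>"
    and "alg_isomorphic D (C0_int \<Omega>)"
    and "alg_action \<Gamma> D \<alpha>"
  shows "(\<exists>(E :: 'd semilat) \<beta> \<phi>. equivariant_surjection \<Gamma> D \<alpha> E \<beta> \<phi>)
    \<and> (\<forall>(E :: 'e semilat) \<beta> \<phi>. equivariant_surjection \<Gamma> D \<alpha> E \<beta> \<phi> \<longrightarrow>
          algebraic_independent_resolution \<Gamma> D \<alpha>
            (res_E D E \<phi>) (res_action D E \<phi> \<beta>) (res_eps \<phi>) (\<lambda>k. res_delta))
    \<and> (torsion_free_group \<Gamma> \<longrightarrow>
          (\<exists>(E :: ('g set \<times> 'd) semilat) \<beta> \<phi>. equivariant_surjection \<Gamma> D \<alpha> E \<beta> \<phi> \<and>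
             algebraic_independent_resolution \<Gamma> D \<alpha>
               (res_E D E \<phi>) (res_action D E \<phi> \<beta>) (res_eps \<phi>) (\<lambda>k. res_delta) \<and>
             (\<forall>k. acts_freely_on_nonzero \<Gamma> (res_E D E \<phi> k) (res_action D E \<phi> \<beta> k))))"
proof -
  interpret resolution_data \<Gamma> D \<alpha>
    using assms(1,8) function_algebra_of_isomorphic[OF assms(2,7)]
    by (simp add: resolution_data_def resolution_data_axioms_def)
  show ?thesis
  proof (intro conjI allI impI)
    show "\<exists>(E :: 'd semilat) \<beta> \<phi>. equivariant_surjection \<Gamma> D \<alpha> E \<beta> \<phi>"
      by (rule idem_equivariant_surjection[OF assms(3)]) blast
  next
    fix E :: "'e semilat" and \<beta> \<phi>
    assume "equivariant_surjection \<Gamma> D \<alpha> E \<beta> \<phi>"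
    then show "algebraic_independent_resolution \<Gamma> D \<alpha>
        (res_E D E \<phi>) (res_action D E \<phi> \<beta>) (res_eps \<phi>) (\<lambda>k. res_delta)"
      by (rule resolution)
  next
    assume tf: "torsion_free_group \<Gamma>"
    obtain \<phi> where \<phi>: "equivariant_surjection \<Gamma> D \<alpha> free_semilattice free_action \<phi>"
      by (rule free_equivariant_surjection[OF assms(3)])
    show "\<exists>(E :: ('g set \<times> 'd) semilat) \<beta> \<phi>. equivariant_surjection \<Gamma> D \<alpha> E \<beta> \<phi> \<and>
        algebraic_independent_resolution \<Gamma> D \<alpha>
          (res_E D E \<phi>) (res_action D E \<phi> \<beta>) (res_eps \<phi>) (\<lambda>k. res_delta) \<and>
        (\<forall>k. acts_freely_on_nonzero \<Gamma> (res_E D E \<phi> k) (res_action D E \<phi> \<beta> k))"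
      using \<phi> resolution[OF \<phi>] resolution_acts_freely[OF \<phi> free_action_free[OF tf]] by blast
  qed
qed

end
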